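(* Let $G$ be a non-trivial discrete group and let $(u_i)_{i\in\mathbb{N}}$ be a sequence in $Z^2(G,\mathbb{T})$. Assume that $G$ is countable and amenable, and has a $\sigma F$-sequence $(F_i)_{i\in\mathbb{N}}$ which satisfies $$\sum_{i} \frac{1}{\# F_{i}} \sum_{y \in F_{i}}|1 - u_{i}(y^{-1},x) | < \infty \quad\text{for all } x \in G.$$ Set $U_i=\lambda_{u_i}$ and $\phi_i:=\chi_{F_i}/(\#F_i)^{1/2}$ for every $i$, where $\chi_{F_i}$ is the characteristic function of $F_i$. Then $\phi=(\phi_i)$ is a sequence of unit vectors in $\ell^2(G)$ such that $\otimes_i U_i$ exists on $\mathcal{H}^{\phi}=\bigotimes_i^{\phi}\ell^2(G)$, i.e. $\otimes_i U_i(x)$ exists on $\mathcal{H}^\phi$ for every $x\in G$.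
   Context: $G$ has neutral element $e$. $Z^2(G,\mathbb{T})$ is the set of normalized 2-cocycles, i.e. maps $u:G\times G\to\mathbb{T}$ (circle group) with $u(x,y)u(xy,z)=u(y,z)u(x,yz)$ and $u(x,e)=u(e,x)=1$ for all $x,y,z\in G$. For $u\in Z^2(G,\mathbb{T})$, the left $u$-regular projective unitary representation $\lambda_u$ of $G$ on $\ell^2(G)$ is defined by $(\lambda_u(x)f)(y)=u(y^{-1},x)f(x^{-1}y)$; it satisfies $\lambda_u(x)\lambda_u(y)=u(x,y)\lambda_u(xy)$. A $\sigma F$-sequence for $G$ is a sequence $(F_i)$ of non-empty finite subsets of $G$ such that $\sum_i \left|1-\frac{\#(F_i\cap xF_i)}{\#F_i}\right|<\infty$ for all $x\in G$. Infinite tensor products: for a sequence of Hilbert spaces $\mathcal{H}_i$ ($i\in\mathbb{N}$) and unit vectors $\phi_i\in\mathcal{H}_i$, $\phi=(\phi_i)$, the space $\mathcal{H}^\phi=\bigotimes_i^{\phi}\mathcal{H}_i$ is the completed inductive limit of the spaces $\mathcal{H}_1\otimes\cdots\otimes\mathcal{H}_n$ under the isometries $\psi\mapsto\psi\otimes\phi_{n+1}$; it is the closed span of the elementary decomposable vectors $\psi_1\otimes\cdots\otimes\psi_k\otimes\phi_{k+1}\otimes\phi_{k+2}\otimes\cdots$. For bounded operators $T_i$ on $\mathcal{H}_i$ and a finite non-empty $J\subset\mathbb{N}$, let $\tilde T_J$ be the bounded operator on $\mathcal{H}^\phi$ acting as $T_i$ in the factors $i\in J$ and as the identity in the others. One says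 that $\otimes_iT_i$ exists on $\mathcal{H}^\phi$ if the net $(\tilde T_J)_J$ (indexed by finite non-empty subsets of $\mathbb{N}$ ordered by inclusion) converges in the strong operator topology to a bounded operator, which is then denoted $\otimes_iT_i$. *)

theory Defs
  imports "HOL-Analysis.Analysis" "HOL-Library.Poly_Mapping"
begin

section \<open>Complex Hilbert spaces\<close>

text \<open>
  A complex inner product space is a real inner product space with a compatible complex
  structure; its norm is the one of \<^class>\<open>real_inner\<close>, so that the square of the norm of
  \<open>x\<close> is \<open>cinner x x\<close>. The inner product is linear in its second argument.
\<close>

class complex_inner = real_inner +
  fixes scaleC :: "complex \<Rightarrow> 'a \<Rightarrow> 'a" (infixr "*\<^sub>C" 75)
    and cinner :: "'a \<Rightarrow> 'a \<Rightarrow> complex"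
  assumes scaleC_add_right: "a *\<^sub>C (x + y) = a *\<^sub>C x + a *\<^sub>C y"
    and scaleC_add_left: "(a + b) *\<^sub>C x = a *\<^sub>C x + b *\<^sub>C x"
    and scaleC_scaleC: "a *\<^sub>C b *\<^sub>C x = (a * b) *\<^sub>C x"
    and scaleC_of_real: "complex_of_real r *\<^sub>C x = r *\<^sub>R x"
    and cinner_commute: "cinner x y = cnj (cinner y x)"
    and cinner_add_right: "cinner x (y + z) = cinner x y + cinner x z"
    and cinner_scaleC_right: "cinner x (a *\<^sub>C y) = a * cinner x y"
    and Re_cinner: "Re (cinner x y) = inner x y"

class chilbert_space = complex_inner + complete_space

lemma scaleC_one [simp]: "1 *\<^sub>C x = (x::'a::complex_inner)"
  using scaleC_of_real[of 1 x] by simp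

global_interpretation complex_vector: vector_space "scaleC :: complex \<Rightarrow> 'a \<Rightarrow> 'a::complex_inner"
  defines cspan = "module.span (scaleC :: complex \<Rightarrow> 'a \<Rightarrow> 'a::complex_inner)"
  by unfold_locales (auto simp: scaleC_add_right scaleC_add_left scaleC_scaleC)

definition bounded_clinear :: "('a::complex_inner \<Rightarrow> 'b::complex_inner) \<Rightarrow> bool" where
  "bounded_clinear S \<longleftrightarrow> bounded_linear S \<and> (\<forall>c x. S (c *\<^sub>C x) = c *\<^sub>C S x)"

lemma cinner_add_left: "cinner (x + y) z = cinner x z + cinner (y::'a::complex_inner) z"
  by (metis cinner_commute cinner_add_right complex_cnj_add)

lemma cinner_scaleC_left: "cinner (a *\<^sub>C x) y = cnj a * cinner (x::'a::complex_inner) y"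
  by (metis cinner_commute cinner_scaleC_right complex_cnj_mult)

lemma cinner_self: "cinner x x = complex_of_real ((norm (x::'a::complex_inner))\<^sup>2)"
proof (rule complex_eqI)
  show "Im (cinner x x) = Im (complex_of_real ((norm x)\<^sup>2))"
    using arg_cong[OF cinner_commute[of x x], of Im] by simp
qed (simp add: Re_cinner power2_norm_eq_inner)

lemma norm_scaleC: "norm (c *\<^sub>C (x::'a::complex_inner)) = cmod c * norm x"
proof -
  have "complex_of_real ((norm (c *\<^sub>C x))\<^sup>2) = (c * cnj c) * complex_of_real ((norm x)\<^sup>2)"
    unfolding cinner_self[symmetric] cinner_scaleC_left cinner_scaleC_right by (simp only: mult_ac)
  also have "\<dots> = complex_of_real ((cmod c * norm x)\<^sup>2)"
    by (simp add: complex_norm_square[symmetric] power_mult_distrib)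
  finally have "(norm (c *\<^sub>C x))\<^sup>2 = (cmod c * norm x)\<^sup>2"
    by (simp only: of_real_eq_iff)
  thus ?thesis by (rule power2_eq_imp_eq) auto
qed


section \<open>The Hilbert space of square-summable functions\<close>

typedef 'a ell2 = "{f :: 'a \<Rightarrow> complex. (\<lambda>x. (cmod (f x))\<^sup>2) summable_on UNIV}"
  morphisms ell2_fun Abs_ell2
  by (rule exI[of _ "\<lambda>_. 0"]) simp

setup_lifting type_definition_ell2

lemma ell2_summable: "(\<lambda>x. (cmod (ell2_fun f x))\<^sup>2) summable_on UNIV"
  using ell2_fun by blast

lemma ell2_eqI: "(\<And>x. ell2_fun f x = ell2_fun g x) \<Longrightarrow> f = g"
  by (simp add: ell2_fun_inject[symmetric] fun_eq_iff)

lemma cmod_mult_le: "cmod (a * b) \<le> (cmod a)\<^sup>2 + (cmod b)\<^sup>2"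
proof -
  have "0 \<le> cmod a * cmod b" by simp
  moreover have "2 * (cmod a * cmod b) \<le> (cmod a)\<^sup>2 + (cmod b)\<^sup>2"
    using sum_squares_bound[of "cmod a" "cmod b"] by (simp only: mult.assoc)
  ultimately show ?thesis unfolding norm_mult by linarith
qed

lemma square_summable_add:
  assumes "(\<lambda>x. (cmod (f x))\<^sup>2) summable_on A" "(\<lambda>x. (cmod (g x))\<^sup>2) summable_on A"
  shows "(\<lambda>x. (cmod (f x + g x))\<^sup>2) summable_on A"
proof (rule summable_on_comparison_test)
  show "(\<lambda>x. 2 * (cmod (f x))\<^sup>2 + 2 * (cmod (g x))\<^sup>2) summable_on A"
    by (intro summable_on_add summable_on_cmult_right assms)
  fix x
  have "(cmod (f x + g x))\<^sup>2 \<le> (cmod (f x) + cmod (g x))\<^sup>2"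
    by (intro power_mono norm_triangle_ineq) auto
  also have "\<dots> \<le> 2 * (cmod (f x))\<^sup>2 + 2 * (cmod (g x))\<^sup>2"
    using sum_squares_bound[of "cmod (f x)" "cmod (g x)"] by (simp add: power2_sum)
  finally show "(cmod (f x + g x))\<^sup>2 \<le> 2 * (cmod (f x))\<^sup>2 + 2 * (cmod (g x))\<^sup>2" .
qed auto

lemma square_summable_mult:
  assumes "(\<lambda>x. (cmod (f x))\<^sup>2) summable_on A" "(\<lambda>x. (cmod (g x))\<^sup>2) summable_on A"
  shows "(\<lambda>x. f x * g x) summable_on A"
proof (rule abs_summable_summable)
  show "(\<lambda>x. norm (f x * g x)) summable_on A"
    by (rule summable_on_comparison_test[OF summable_on_add[OF assms]]) (auto intro: cmod_mult_le)
qed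

instantiation ell2 :: (type) complex_inner
begin

lift_definition zero_ell2 :: "'a ell2" is "\<lambda>_. 0" by simp

lift_definition uminus_ell2 :: "'a ell2 \<Rightarrow> 'a ell2" is "\<lambda>f x. - f x" by simp

lift_definition plus_ell2 :: "'a ell2 \<Rightarrow> 'a ell2 \<Rightarrow> 'a ell2" is "\<lambda>f g x. f x + g x"
  by (rule square_summable_add)

lift_definition minus_ell2 :: "'a ell2 \<Rightarrow> 'a ell2 \<Rightarrow> 'a ell2" is "\<lambda>f g x. f x - g x"
proof -
  fix f g :: "'a \<Rightarrow> complex"
  assume "(\<lambda>x. (cmod (f x))\<^sup>2) summable_on UNIV" "(\<lambda>x. (cmod (g x))\<^sup>2) summable_on UNIV"
  thus "(\<lambda>x. (cmod (f x - g x))\<^sup>2) summable_on UNIV"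
    using square_summable_add[of f UNIV "\<lambda>x. - g x"] by simp
qed

lift_definition scaleC_ell2 :: "complex \<Rightarrow> 'a ell2 \<Rightarrow> 'a ell2" is "\<lambda>c f x. c * f x"
  by (simp add: norm_mult power_mult_distrib summable_on_cmult_right)

definition scaleR_ell2 :: "real \<Rightarrow> 'a ell2 \<Rightarrow> 'a ell2" where
  "scaleR_ell2 r f = complex_of_real r *\<^sub>C f"

definition cinner_ell2 :: "'a ell2 \<Rightarrow> 'a ell2 \<Rightarrow> complex" where
  "cinner_ell2 f g = (\<Sum>\<^sub>\<infinity>x. cnj (ell2_fun f x) * ell2_fun g x)"

definition inner_ell2 :: "'a ell2 \<Rightarrow> 'a ell2 \<Rightarrow> real" where
  "inner_ell2 f g = Re (cinner f g)"

definition norm_ell2 :: "'a ell2 \<Rightarrow> real" where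
  "norm_ell2 f = sqrt (inner f f)"

definition sgn_ell2 :: "'a ell2 \<Rightarrow> 'a ell2" where
  "sgn_ell2 f = inverse (norm f) *\<^sub>R f"

definition dist_ell2 :: "'a ell2 \<Rightarrow> 'a ell2 \<Rightarrow> real" where
  "dist_ell2 f g = norm (f - g)"

definition uniformity_ell2 :: "('a ell2 \<times> 'a ell2) filter" where
  "uniformity_ell2 = (INF e\<in>{0<..}. principal {(f, g). dist f g < e})"

definition open_ell2 :: "'a ell2 set \<Rightarrow> bool" where
  "open_ell2 U \<longleftrightarrow> (\<forall>x\<in>U. eventually (\<lambda>(x', y). x' = x \<longrightarrow> y \<in> U) uniformity)"

lemma ell2_cnj_mult_summable: "(\<lambda>x. cnj (ell2_fun f x) * ell2_fun g x) summable_on UNIV"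
  by (rule square_summable_mult) (auto simp: ell2_summable)

lemma cinner_ell2_self: "cinner f f = complex_of_real (\<Sum>\<^sub>\<infinity>x. (cmod (ell2_fun f x))\<^sup>2)"
proof -
  have "cinner f f = (\<Sum>\<^sub>\<infinity>x. complex_of_real ((cmod (ell2_fun f x))\<^sup>2))"
    unfolding cinner_ell2_def complex_norm_square by (simp add: mult.commute)
  also have "\<dots> = complex_of_real (\<Sum>\<^sub>\<infinity>x. (cmod (ell2_fun f x))\<^sup>2)"
    by (intro infsumI has_sum_of_real has_sum_infsum ell2_summable)
  finally show ?thesis .
qed

instance
proof
  fix x y z :: "'a ell2" and r s :: real and a b :: complex
  show "x + y + z = x + (y + z)" "x + y = y + x" "0 + x = x" "- x + x = 0" "x - y = x + - y"
    by (transfer; simp add: fun_eq_iff)+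
  show "a *\<^sub>C (x + y) = a *\<^sub>C x + a *\<^sub>C y" "(a + b) *\<^sub>C x = a *\<^sub>C x + b *\<^sub>C x"
    "a *\<^sub>C b *\<^sub>C x = (a * b) *\<^sub>C x"
    by (transfer; simp add: algebra_simps)+
  show "r *\<^sub>R (x + y) = r *\<^sub>R x + r *\<^sub>R y" "(r + s) *\<^sub>R x = r *\<^sub>R x + s *\<^sub>R x"
    "r *\<^sub>R s *\<^sub>R x = (r * s) *\<^sub>R x" "1 *\<^sub>R x = x"
    unfolding scaleR_ell2_def by (transfer; simp add: algebra_simps)+
  show "complex_of_real r *\<^sub>C x = r *\<^sub>R x"
    by (simp add: scaleR_ell2_def)
  show cc: "cinner x y = cnj (cinner y x)" for x y :: "'a ell2"
    unfolding cinner_ell2_def by (subst infsum_cnj[symmetric]) (simp add: mult.commute)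
  show ca: "cinner x (y + z) = cinner x y + cinner x z"
    unfolding cinner_ell2_def
    by (subst infsum_add[symmetric])
      (simp_all add: ell2_cnj_mult_summable plus_ell2.rep_eq distrib_left)
  show cs: "cinner x (a *\<^sub>C y) = a * cinner x y" for x y :: "'a ell2" and a
    unfolding cinner_ell2_def
    by (subst infsum_cmult_right[symmetric])
      (simp_all add: ell2_cnj_mult_summable scaleC_ell2.rep_eq mult.left_commute)
  show "Re (cinner x y) = inner x y"
    by (simp add: inner_ell2_def)
  show ic: "inner x y = inner y x" for x y :: "'a ell2"
    unfolding inner_ell2_def by (subst cc) simp
  show "inner (x + y) z = inner x z + inner y z"
  proof -
    have "cinner (x + y) z = cnj (cinner z (x + y))" by (rule cc)
    also have "\<dots> = cnj (cinner z x) + cnj (cinner z y)"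
      unfolding cinner_ell2_def
      by (subst complex_cnj_add[symmetric], subst infsum_add[symmetric])
        (simp_all add: ell2_cnj_mult_summable plus_ell2.rep_eq distrib_right distrib_left)
    also have "\<dots> = cinner x z + cinner y z" by (simp only: cc[of x z] cc[of y z])
    finally show ?thesis by (simp add: inner_ell2_def)
  qed
  show "inner (r *\<^sub>R x) y = r * inner x y"
    unfolding ic[of _ y] by (simp add: inner_ell2_def scaleR_ell2_def cs)
  show "0 \<le> inner x x"
    unfolding inner_ell2_def cinner_ell2_self Re_complex_of_real by (rule infsum_nonneg) simp
  show "inner x x = 0 \<longleftrightarrow> x = 0"
  proof
    assume "inner x x = 0"
    hence "(\<Sum>\<^sub>\<infinity>t. (cmod (ell2_fun x t))\<^sup>2) = 0"
      unfolding inner_ell2_def cinner_ell2_self by simp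
    hence "(cmod (ell2_fun x t))\<^sup>2 = 0" for t
      using nonneg_infsum_le_0D[OF _ ell2_summable[of x], of t] by simp
    thus "x = 0" by (simp add: ell2_fun_inject[symmetric] fun_eq_iff zero_ell2.rep_eq)
  qed (simp add: inner_ell2_def cinner_ell2_self zero_ell2.rep_eq)
qed (rule norm_ell2_def sgn_ell2_def dist_ell2_def uniformity_ell2_def open_ell2_def)+

end

lemma norm_ell2_squared: "(norm f)\<^sup>2 = (\<Sum>\<^sub>\<infinity>x. (cmod (ell2_fun f x))\<^sup>2)"
  using cinner_self[of f] unfolding cinner_ell2_self by (simp only: of_real_eq_iff)

lemma sum_le_norm_ell2:
  assumes "finite A"
  shows "(\<Sum>x\<in>A. (cmod (ell2_fun f x))\<^sup>2) \<le> (norm f)\<^sup>2"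
  unfolding norm_ell2_squared by (rule finite_sum_le_infsum[OF ell2_summable assms]) auto

lemma cmod_le_norm_ell2: "cmod (ell2_fun f x) \<le> norm f"
  by (rule power2_le_imp_le) (use sum_le_norm_ell2[of "{x}" f] in auto)

instance ell2 :: (type) chilbert_space
proof
  fix X :: "nat \<Rightarrow> 'a ell2"
  assume X: "Cauchy X"
  have "Cauchy (\<lambda>n. ell2_fun (X n) x)" for x
    unfolding Cauchy_def
  proof (intro allI impI)
    fix e :: real assume "e > 0"
    then obtain M where M: "\<And>m n. m \<ge> M \<Longrightarrow> n \<ge> M \<Longrightarrow> dist (X m) (X n) < e"
      using X unfolding Cauchy_def by blast
    have "dist (ell2_fun (X m) x) (ell2_fun (X n) x) < e" if "m \<ge> M" "n \<ge> M" for m n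
      using M[OF that] cmod_le_norm_ell2[of "X m - X n" x]
      by (simp add: dist_norm minus_ell2.rep_eq)
    thus "\<exists>M. \<forall>m\<ge>M. \<forall>n\<ge>M. dist (ell2_fun (X m) x) (ell2_fun (X n) x) < e" by blast
  qed
  hence "convergent (\<lambda>n. ell2_fun (X n) x)" for x
    by (simp add: Cauchy_convergent_iff)
  moreover define f where "f = (\<lambda>x. lim (\<lambda>n. ell2_fun (X n) x))"
  ultimately have f: "(\<lambda>n. ell2_fun (X n) x) \<longlonglongrightarrow> f x" for x
    by (simp add: convergent_LIMSEQ_iff)
  have *: "\<exists>M. \<forall>n\<ge>M. \<forall>A. finite A \<longrightarrow> (\<Sum>x\<in>A. (cmod (ell2_fun (X n) x - f x))\<^sup>2) \<le> e\<^sup>2"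
    if "e > 0" for e
  proof -
    obtain M where M: "\<And>m n. m \<ge> M \<Longrightarrow> n \<ge> M \<Longrightarrow> dist (X m) (X n) < e"
      using X \<open>e > 0\<close> unfolding Cauchy_def by blast
    have "(\<Sum>x\<in>A. (cmod (ell2_fun (X n) x - f x))\<^sup>2) \<le> e\<^sup>2" if "n \<ge> M" "finite A" for n A
    proof (rule LIMSEQ_le_const2)
      show "(\<lambda>m. \<Sum>x\<in>A. (cmod (ell2_fun (X n) x - ell2_fun (X m) x))\<^sup>2)
          \<longlonglongrightarrow> (\<Sum>x\<in>A. (cmod (ell2_fun (X n) x - f x))\<^sup>2)"
        by (intro tendsto_intros f)
      have "(\<Sum>x\<in>A. (cmod (ell2_fun (X n) x - ell2_fun (X m) x))\<^sup>2) \<le> e\<^sup>2" if "m \<ge> M" for m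
      proof -
        have "(\<Sum>x\<in>A. (cmod (ell2_fun (X n) x - ell2_fun (X m) x))\<^sup>2) \<le> (norm (X n - X m))\<^sup>2"
          using sum_le_norm_ell2[OF \<open>finite A\<close>, of "X n - X m"] by (simp add: minus_ell2.rep_eq)
        also have "\<dots> \<le> e\<^sup>2"
          using M[OF \<open>n \<ge> M\<close> that] by (intro power_mono) (auto simp: dist_norm)
        finally show ?thesis .
      qed
      thus "\<exists>N. \<forall>m\<ge>N. (\<Sum>x\<in>A. (cmod (ell2_fun (X n) x - ell2_fun (X m) x))\<^sup>2) \<le> e\<^sup>2" by blast
    qed
    thus ?thesis by blast
  qed
  have sm: "\<exists>M. \<forall>n\<ge>M. (\<lambda>x. (cmod (ell2_fun (X n) x - f x))\<^sup>2) summable_on UNIV \<and>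
      (\<Sum>\<^sub>\<infinity>x. (cmod (ell2_fun (X n) x - f x))\<^sup>2) \<le> e\<^sup>2" if e: "e > 0" for e
  proof -
    obtain M where M: "\<And>n A. n \<ge> M \<Longrightarrow> finite A \<Longrightarrow>
        (\<Sum>x\<in>A. (cmod (ell2_fun (X n) x - f x))\<^sup>2) \<le> e\<^sup>2"
      using *[OF e] by blast
    have "(\<lambda>x. (cmod (ell2_fun (X n) x - f x))\<^sup>2) summable_on UNIV" if "n \<ge> M" for n
      
    proof (rule nonneg_bdd_above_summable_on)
      show "bdd_above (sum (\<lambda>x. (cmod (ell2_fun (X n) x - f x))\<^sup>2) ` {F. F \<subseteq> UNIV \<and> finite F})"
        using M[OF that] by (intro bdd_aboveI2[of _ _ "e\<^sup>2"]) simp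
    qed simp
    moreover have "(\<Sum>\<^sub>\<infinity>x. (cmod (ell2_fun (X n) x - f x))\<^sup>2) \<le> e\<^sup>2" if "n \<ge> M" for n
      by (rule infsum_le_finite_sums[OF calculation[OF that] M[OF that]])
    ultimately show ?thesis by blast
  qed
  obtain M where M: "(\<lambda>x. (cmod (ell2_fun (X M) x - f x))\<^sup>2) summable_on UNIV"
    using sm[of 1] by auto
  have "(\<lambda>x. (cmod (ell2_fun (X M) x + - (ell2_fun (X M) x - f x)))\<^sup>2) summable_on UNIV"
    by (rule square_summable_add[OF ell2_summable]) (simp only: norm_minus_cancel M)
  hence F: "ell2_fun (Abs_ell2 f) = f"
    by (simp add: Abs_ell2_inverse)
  have "X \<longlonglongrightarrow> Abs_ell2 f"
  proof (rule metric_LIMSEQ_I)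
    fix r :: real assume "r > 0"
    then obtain M where M: "\<And>n. n \<ge> M \<Longrightarrow> (\<Sum>\<^sub>\<infinity>x. (cmod (ell2_fun (X n) x - f x))\<^sup>2) \<le> (r/2)\<^sup>2"
      using sm[of "r/2"] by auto
    have "dist (X n) (Abs_ell2 f) < r" if "n \<ge> M" for n
    proof -
      have "(norm (X n - Abs_ell2 f))\<^sup>2 \<le> (r/2)\<^sup>2"
        using M[OF that] by (simp only: norm_ell2_squared minus_ell2.rep_eq F)
      hence "norm (X n - Abs_ell2 f) \<le> r/2"
        by (rule power2_le_imp_le) (use \<open>r > 0\<close> in simp)
      thus ?thesis using \<open>r > 0\<close> by (simp add: dist_norm)
    qed
    thus "\<exists>M. \<forall>n\<ge>M. dist (X n) (Abs_ell2 f) < r" by blast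
  qed
  thus "convergent X" unfolding convergent_def by blast
qed

text \<open>The characteristic function of a finite set; \<open>ell2_fun_chi\<close> is its intended meaning.\<close>

definition chi :: "'a set \<Rightarrow> 'a ell2" where
  "chi A = Abs_ell2 (indicator A)"

lemma ell2_fun_chi:
  assumes "finite A"
  shows "ell2_fun (chi A) = indicator A"
proof -
  have "(\<lambda>x. (cmod (indicator A x))\<^sup>2) summable_on UNIV"
  proof (subst summable_on_cong_neutral)
    show "(\<lambda>_. 1::real) summable_on A" using assms by simp
  qed (auto simp: indicator_def)
  thus ?thesis by (simp add: chi_def Abs_ell2_inverse)
qed


section \<open>Projective regular representations and amenability\<close>

text \<open>
  Groups are types of class \<^class>\<open>group_add\<close>, which does not assume commutativity: the product
  \<open>x y\<close> is written \<open>x + y\<close>, the inverse of \<open>x\<close> is \<open>- x\<close> and the neutral element is \<open>0\<close>.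
\<close>

definition normalized_cocycles :: "('g::group_add \<Rightarrow> 'g \<Rightarrow> complex) set" where
  "normalized_cocycles = {u.
     (\<forall>x y. cmod (u x y) = 1) \<and>
     (\<forall>x y z. u x y * u (x + y) z = u y z * u x (y + z)) \<and>
     (\<forall>x. u x 0 = 1 \<and> u 0 x = 1)}"

text \<open>The left \<open>u\<close>-regular projective representation; see \<open>ell2_fun_proj_regular\<close>.\<close>

definition proj_regular :: "('g::group_add \<Rightarrow> 'g \<Rightarrow> complex) \<Rightarrow> 'g \<Rightarrow> 'g ell2 \<Rightarrow> 'g ell2" where
  "proj_regular u x f = Abs_ell2 (\<lambda>y. u (- y) x * ell2_fun f (- x + y))"

lemma ell2_fun_proj_regular:
  assumes "u \<in> normalized_cocycles"
  shows "ell2_fun (proj_regular u x f) y = u (- y) x * ell2_fun f (- x + y)"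
proof -
  have "bij_betw (\<lambda>y. - x + y) UNIV UNIV"
    by (rule bij_betwI[where g = "\<lambda>y. x + y"]) (auto simp: add.assoc[symmetric])
  hence "(\<lambda>y. (cmod (ell2_fun f (- x + y)))\<^sup>2) summable_on UNIV"
    using summable_on_reindex_bij_betw[of "\<lambda>y. - x + y" UNIV UNIV "\<lambda>y. (cmod (ell2_fun f y))\<^sup>2"]
      ell2_summable[of f] by simp
  thus ?thesis
    using assms by (simp add: proj_regular_def Abs_ell2_inverse norm_mult normalized_cocycles_def)
qed

lemma proj_regular_mult:
  assumes "u \<in> normalized_cocycles"
  shows "proj_regular u x (proj_regular u y f) = u x y *\<^sub>C proj_regular u (x + y) f"
proof (rule ell2_eqI)
  fix z
  have "u (- z) x * u (- z + x) y = u x y * u (- z) (x + y)"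
    using assms by (simp add: normalized_cocycles_def)
  moreover have "- (- x + z) = - z + x" "- y + (- x + z) = - (x + y) + z"
    by (simp_all add: minus_add add.assoc[symmetric])
  ultimately show "ell2_fun (proj_regular u x (proj_regular u y f)) z
      = ell2_fun (u x y *\<^sub>C proj_regular u (x + y) f) z"
    by (simp add: ell2_fun_proj_regular[OF assms] scaleC_ell2.rep_eq mult.assoc[symmetric])
qed

text \<open>Existence of a left-invariant mean on the bounded real-valued functions on \<open>'g\<close>.\<close>

definition amenable :: "'g::group_add itself \<Rightarrow> bool" where
  "amenable _ \<longleftrightarrow> (\<exists>m :: ('g \<Rightarrow> real) \<Rightarrow> real.
     (\<forall>f g. bounded (range f) \<longrightarrow> bounded (range g) \<longrightarrow> m (\<lambda>y. f y + g y) = m f + m g) \<and>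
     (\<forall>c f. bounded (range f) \<longrightarrow> m (\<lambda>y. c * f y) = c * m f) \<and>
     (\<forall>f. bounded (range f) \<longrightarrow> (\<forall>y. f y \<ge> 0) \<longrightarrow> m f \<ge> 0) \<and>
     m (\<lambda>_. 1) = 1 \<and>
     (\<forall>f x. bounded (range f) \<longrightarrow> m (\<lambda>y. f (- x + y)) = m f))"

definition sigma_F_sequence :: "(nat \<Rightarrow> 'g::group_add set) \<Rightarrow> bool" where
  "sigma_F_sequence F \<longleftrightarrow>
     (\<forall>i. finite (F i) \<and> F i \<noteq> {}) \<and>
     (\<forall>x. summable (\<lambda>i. \<bar>1 - real (card (F i \<inter> (\<lambda>y. x + y) ` F i)) / real (card (F i))\<bar>))"


section \<open>Infinite tensor products\<close>

text \<open>
  \<open>t\<close> exhibits \<open>hilbert_tensor_space t\<close> as the Hilbert space tensor product of copies of \<open>'a\<close>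
  indexed by \<open>A\<close>, with \<open>t \<psi>\<close> the elementary tensor of the vectors \<open>\<psi> i\<close> for \<open>i \<in> A\<close>. The values
  of \<open>\<psi>\<close> outside \<open>A\<close> are irrelevant.
\<close>

definition hilbert_tensor_space :: "(('i \<Rightarrow> 'a) \<Rightarrow> 'h::chilbert_space) \<Rightarrow> 'h set" where
  "hilbert_tensor_space t = closure (cspan (range t))"

locale hilbert_tensor =
  fixes A :: "'i set" and t :: "('i \<Rightarrow> 'a::chilbert_space) \<Rightarrow> 'h::chilbert_space"
  assumes cong: "(\<And>i. i \<in> A \<Longrightarrow> \<psi> i = \<eta> i) \<Longrightarrow> t \<psi> = t \<eta>"
    and add: "i \<in> A \<Longrightarrow> t (\<psi>(i := v + w)) = t (\<psi>(i := v)) + t (\<psi>(i := w))"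
    and scaleC: "i \<in> A \<Longrightarrow> t (\<psi>(i := c *\<^sub>C v)) = c *\<^sub>C t (\<psi>(i := v))"
    and cinner: "cinner (t \<psi>) (t \<eta>) = (\<Prod>i\<in>A. cinner (\<psi> i) (\<eta> i))"

text \<open>
  The completed inductive limit \<open>'h\<close> of the \<open>n\<close>-fold tensor products of \<open>'a\<close> along the isometries
  that tensor with \<open>\<phi> n\<close>, the stages being realised as closed subspaces of the limit. The stage
  inclusion is determined by its values on elementary tensors, which \<open>connect\<close> prescribes.
  Thus \<open>tens n \<psi>\<close> is the elementary decomposable vector
  \<open>\<psi> 0 \<otimes> \<dots> \<otimes> \<psi> (n - 1) \<otimes> \<phi> n \<otimes> \<phi> (n + 1) \<otimes> \<dots>\<close>. These data are determined up to a unique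
  unitary; for the spaces \<^typ>\<open>'g ell2\<close> they exist by \<open>infinite_tensor_product_exists\<close> below.
\<close>

locale infinite_tensor_product =
  fixes \<phi> :: "nat \<Rightarrow> 'a::chilbert_space"
    and tens :: "nat \<Rightarrow> (nat \<Rightarrow> 'a) \<Rightarrow> 'h::chilbert_space"
  assumes unit: "norm (\<phi> n) = 1"
    and tensor: "hilbert_tensor {..<n} (tens n)"
    and connect: "tens (Suc n) (\<psi>(n := \<phi> n)) = tens n \<psi>"
    and dense: "closure (\<Union>n. hilbert_tensor_space (tens n)) = UNIV"

text \<open>
  \<open>S\<close> acts as \<open>T i\<close> in the factors \<open>i \<in> J\<close> and as the identity in the others. It is enough to
  consider \<open>n\<close> with \<open>J \<subseteq> {..<n}\<close>, since \<open>tens m \<psi>\<close> is of the form \<open>tens n \<psi>'\<close> for \<open>m \<le> n\<close>.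
\<close>

definition acts_on_factors ::
    "(nat \<Rightarrow> (nat \<Rightarrow> 'a) \<Rightarrow> 'h::chilbert_space) \<Rightarrow> (nat \<Rightarrow> 'a \<Rightarrow> 'a) \<Rightarrow> nat set \<Rightarrow> ('h \<Rightarrow> 'h) \<Rightarrow> bool"
  where
  "acts_on_factors tens T J S \<longleftrightarrow> bounded_clinear S \<and>
     (\<forall>n \<psi>. J \<subseteq> {..<n} \<longrightarrow> S (tens n \<psi>) = tens n (\<lambda>i. if i \<in> J then T i (\<psi> i) else \<psi> i))"

text \<open>
  Strong operator convergence of the net of the operators that act as \<open>T i\<close> for \<open>i \<in> J\<close>.
  These operators \<open>TJ J\<close> are unique by \<open>acts_on_factors_unique\<close> below.
\<close>

definition tensor_operator_exists ::
    "(nat \<Rightarrow> (nat \<Rightarrow> 'a) \<Rightarrow> 'h::chilbert_space) \<Rightarrow> (nat \<Rightarrow> 'a \<Rightarrow> 'a) \<Rightarrow> bool" where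
  "tensor_operator_exists tens T \<longleftrightarrow>
     (\<exists>TJ S. (\<forall>J. finite J \<and> J \<noteq> {} \<longrightarrow> acts_on_factors tens T J (TJ J)) \<and>
        bounded_clinear S \<and>
        (\<forall>v. ((\<lambda>J. TJ J v) \<longlongrightarrow> S v) (finite_subsets_at_top UNIV)))"

lemma (in infinite_tensor_product) tens_extend:
  assumes "m \<le> n"
  shows "tens m \<psi> = tens n (\<lambda>i. if i < m then \<psi> i else \<phi> i)"
  using assms
proof (induction n rule: dec_induct)
  case base
  show ?case by (rule hilbert_tensor.cong[OF tensor]) simp
next
  case (step n)
  have "tens n (\<lambda>i. if i < m then \<psi> i else \<phi> i)
      = tens (Suc n) ((\<lambda>i. if i < m then \<psi> i else \<phi> i)(n := \<phi> n))"
    by (rule connect[symmetric])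
  also have "(\<lambda>i. if i < m then \<psi> i else \<phi> i)(n := \<phi> n) = (\<lambda>i. if i < m then \<psi> i else \<phi> i)"
    using step by auto
  finally show ?case using step by simp
qed

lemma (in infinite_tensor_product) acts_on_factors_unique:
  assumes "finite J" "acts_on_factors tens T J S" "acts_on_factors tens T J S'"
  shows "S = S'"
proof -
  have lin: "bounded_linear S" "bounded_linear S'"
    and sc: "\<And>c x. S (c *\<^sub>C x) = c *\<^sub>C S x" "\<And>c x. S' (c *\<^sub>C x) = c *\<^sub>C S' x"
    using assms by (auto simp: acts_on_factors_def bounded_clinear_def)
  have cont: "continuous_on X S" "continuous_on X S'" for X
    by (intro linear_continuous_on lin)+
  obtain k where k: "J \<subseteq> {..<k}"
    using finite_nat_bounded[OF \<open>finite J\<close>] by auto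
  have tens: "S (tens m \<psi>) = S' (tens m \<psi>)" for m \<psi>
  proof -
    have "J \<subseteq> {..<max m k}" using k by auto
    thus ?thesis
      using assms(2,3) tens_extend[of m "max m k" \<psi>] by (simp add: acts_on_factors_def)
  qed
  have eq: "S x = S' x" if "x \<in> cspan (range (tens m))" for x m
    using that
  proof (induction rule: complex_vector.span_induct_alt)
    case base
    show ?case by (simp add: linear_0 bounded_linear.linear lin)
  next
    case (step c x y)
    thus ?case by (auto simp: tens sc linear_add bounded_linear.linear lin)
  qed
  have closed: "closed {x. S x = S' x}"
    by (intro closed_Collect_eq cont)
  have "hilbert_tensor_space (tens m) \<subseteq> {x. S x = S' x}" for m
    unfolding hilbert_tensor_space_def by (rule closure_minimal[OF _ closed]) (use eq in auto)
  hence "closure (\<Union>m. hilbert_tensor_space (tens m)) \<subseteq> {x. S x = S' x}"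
    by (intro closure_minimal[OF _ closed]) auto
  thus ?thesis using dense by auto
qed


subsection \<open>Existence of infinite tensor products of square-summable functions\<close>

lemma cinner_diff_right: "cinner x (y - z) = cinner x y - cinner x (z::'a::complex_inner)"
  by (metis add_diff_cancel cinner_add_right diff_add_cancel)

lemma cinner_diff_left: "cinner (x - y) z = cinner x z - cinner y (z::'a::complex_inner)"
  by (metis add_diff_cancel cinner_add_left diff_add_cancel)

lemma exists_unitary:
  fixes a b :: "'a::complex_inner"
  assumes "norm a = 1" "norm b = 1"
  shows "\<exists>W. (\<forall>x y. W (x + y) = W x + W y) \<and> (\<forall>c x. W (c *\<^sub>C x) = c *\<^sub>C W x) \<and>
    (\<forall>x y. cinner (W x) (W y) = cinner x y) \<and> surj W \<and> W a = b"
proof -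
  define z where "z = cinner b a"
  define \<theta> where "\<theta> = (if z = 0 then 1 else cnj z / complex_of_real (cmod z))"
  have zz: "z * cnj z = complex_of_real (cmod z) * complex_of_real (cmod z)"
    using complex_norm_square[of z] by (simp add: power2_eq_square)
  have \<theta>: "cnj \<theta> * \<theta> = 1"
    by (simp add: \<theta>_def zz)
  have \<theta>z: "\<theta> * z = complex_of_real (cmod z)"
    by (simp add: \<theta>_def zz mult.commute[of "cnj z"])
  define a' where "a' = \<theta> *\<^sub>C a"
  have bb: "cinner b b = 1" and "cinner a a = 1"
    using assms by (simp_all add: cinner_self)
  hence aa: "cinner a' a' = 1"
    using \<theta> by (simp add: a'_def cinner_scaleC_left cinner_scaleC_right mult.commute[of \<theta>])
  have ba: "cinner b a' = complex_of_real (cmod z)"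
    by (simp add: a'_def cinner_scaleC_right \<theta>z flip: z_def)
  have ab: "cinner a' b = complex_of_real (cmod z)"
    using cinner_commute[of a' b] ba by simp
  define w where "w = a' - b"
  define n where "n = cinner w w"
  define R where "R x = x - (2 * cinner w x / n) *\<^sub>C w" for x
  have n: "n = 2 - 2 * complex_of_real (cmod z)"
    by (simp add: n_def w_def cinner_diff_left cinner_diff_right aa bb ab ba)
  hence n_real: "cnj n = n" by simp
  have R_add: "R (x + y) = R x + R y" for x y
    by (simp add: R_def cinner_add_right distrib_left add_divide_distrib scaleC_add_left)
  have R_scale: "R (c *\<^sub>C x) = c *\<^sub>C R x" for c x
    by (simp add: R_def cinner_scaleC_right complex_vector.scale_right_diff_distrib scaleC_scaleC
        mult.left_commute)
  have R_inner: "cinner (R x) (R y) = cinner x y" for x y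
  proof (cases "n = 0")
    case False
    define p q where "p = 2 * cinner w x / n" and "q = 2 * cinner w y / n"
    have wx: "cinner w x = p * n / 2" and wy: "cinner w y = q * n / 2"
      using False by (simp_all add: p_def q_def)
    have xw: "cinner x w = cnj p * n / 2"
      unfolding cinner_commute[of x w] wx by (simp add: n_real)
    have "cinner (R x) (R y) = cinner x y - q * cinner x w - cnj p * (cinner w y - q * n)"
      unfolding R_def p_def[symmetric] q_def[symmetric]
      by (simp add: cinner_diff_left cinner_diff_right cinner_scaleC_left cinner_scaleC_right
          n_def[symmetric] right_diff_distrib)
    thus ?thesis by (simp add: xw wy algebra_simps)
  qed (simp add: R_def)
  have R_R: "R (R x) = x" for x
  proof (cases "n = 0")
    case False
    have "cinner w (R x) = - cinner w x"
      using False by (simp add: R_def cinner_diff_right cinner_scaleC_right n_def[symmetric])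
    thus ?thesis by (simp add: R_def complex_vector.scale_minus_left)
  qed (simp add: R_def)
  have R_a: "R a' = b"
  proof (cases "n = 0")
    case True
    hence "w = 0" by (simp add: n_def cinner_self)
    thus ?thesis by (simp add: R_def w_def)
  next
    case False
    have "2 * cinner w a' = n"
      by (simp add: n w_def cinner_diff_left aa ba)
    thus ?thesis using False by (simp add: R_def w_def)
  qed
  show ?thesis
  proof (intro exI[of _ "\<lambda>x. R (\<theta> *\<^sub>C x)"] conjI allI)
    show "surj (\<lambda>x. R (\<theta> *\<^sub>C x))"
    proof (rule surjI)
      fix x
      show "R (\<theta> *\<^sub>C cnj \<theta> *\<^sub>C R x) = x"
        using \<theta> by (simp add: scaleC_scaleC R_R mult.commute)
    qed
    show "cinner (R (\<theta> *\<^sub>C x)) (R (\<theta> *\<^sub>C y)) = cinner x y" for x y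
      using \<theta> by (simp add: R_inner cinner_scaleC_left cinner_scaleC_right mult.commute[of \<theta>])
    show "R (\<theta> *\<^sub>C c *\<^sub>C x) = c *\<^sub>C R (\<theta> *\<^sub>C x)" for c x
      by (simp add: R_scale scaleC_scaleC mult.commute)
  qed (simp_all add: R_add scaleC_add_right R_a flip: a'_def)
qed

lemma summable_on_prod_PiE:
  fixes f :: "nat \<Rightarrow> 'b \<Rightarrow> real"
  assumes nn: "\<And>i x. f i x \<ge> 0" and sm: "\<And>i. f i summable_on UNIV"
  shows "(\<lambda>g. \<Prod>i<n. f i (g i)) summable_on (PiE {..<n} (\<lambda>_. UNIV))"
proof (rule nonneg_bdd_above_summable_on)
  show "bdd_above (sum (\<lambda>g. \<Prod>i<n. f i (g i)) ` {F. F \<subseteq> {..<n} \<rightarrow>\<^sub>E UNIV \<and> finite F})"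
  proof (rule bdd_aboveI2)
    fix F :: "(nat \<Rightarrow> 'b) set" assume "F \<in> {F. F \<subseteq> {..<n} \<rightarrow>\<^sub>E UNIV \<and> finite F}"
    hence F: "F \<subseteq> {..<n} \<rightarrow>\<^sub>E UNIV" "finite F" by auto
    define B where "B = (\<Union>g\<in>F. g ` {..<n})"
    have B: "finite B" using F by (simp add: B_def)
    have FB: "F \<subseteq> {..<n} \<rightarrow>\<^sub>E B" using F(1) unfolding B_def PiE_def by blast
    have "(\<Sum>g\<in>F. \<Prod>i<n. f i (g i)) \<le> (\<Sum>g\<in>{..<n} \<rightarrow>\<^sub>E B. \<Prod>i<n. f i (g i))"
      using FB B by (intro sum_mono2 finite_PiE) (auto intro: prod_nonneg nn)
    also have "\<dots> = (\<Prod>i<n. \<Sum>x\<in>B. f i x)"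
      by (rule prod_sum_PiE[symmetric]) (use B in auto)
    also have "\<dots> \<le> (\<Prod>i<n. \<Sum>\<^sub>\<infinity>x. f i x)"
    proof (intro prod_mono conjI)
      show "0 \<le> sum (f i) B" for i by (rule sum_nonneg) (rule nn)
      show "sum (f i) B \<le> infsum (f i) UNIV" for i
        by (rule finite_sum_le_infsum[OF sm B]) (auto simp: nn)
    qed
    finally show "(\<Sum>g\<in>F. \<Prod>i<n. f i (g i)) \<le> (\<Prod>i<n. \<Sum>\<^sub>\<infinity>x. f i x)" .
  qed
qed (auto intro: prod_nonneg nn)

definition supp_below :: "nat \<Rightarrow> (nat \<Rightarrow>\<^sub>0 'g::zero) set" where
  "supp_below n = {x. \<forall>i\<ge>n. Poly_Mapping.lookup x i = 0}"

lemma bij_betw_supp_below: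
  "bij_betw (\<lambda>x. restrict (Poly_Mapping.lookup x) {..<n}) (supp_below n) (PiE {..<n} (\<lambda>_. UNIV :: 'g::zero set))"
proof (rule bij_betwI[where g = "\<lambda>g. Abs_poly_mapping (\<lambda>i. if i < n then g i else 0)"])
  have L: "Poly_Mapping.lookup (Abs_poly_mapping (\<lambda>i. if i < n then g i else 0)) = (\<lambda>i. if i < n then g i else 0)"
    for g :: "nat \<Rightarrow> 'g"
    by (rule lookup_Abs_poly_mapping) (auto intro: finite_subset[of _ "{..<n}"])
  show "(\<lambda>g. Abs_poly_mapping (\<lambda>i. if i < n then g i else 0)) \<in> ({..<n} \<rightarrow>\<^sub>E UNIV) \<rightarrow> supp_below n"
    by (auto simp: supp_below_def L)
  show "Abs_poly_mapping (\<lambda>i. if i < n then restrict (Poly_Mapping.lookup x) {..<n} i else 0) = x"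
    if "x \<in> supp_below n" for x :: "nat \<Rightarrow>\<^sub>0 'g"
    using that by (intro poly_mapping_eqI) (auto simp: L supp_below_def)
  show "restrict (Poly_Mapping.lookup (Abs_poly_mapping (\<lambda>i. if i < n then g i else 0))) {..<n} = g"
    if "g \<in> {..<n} \<rightarrow>\<^sub>E UNIV" for g :: "nat \<Rightarrow> 'g"
    using that by (auto simp: L fun_eq_iff restrict_def PiE_iff extensional_def)
qed auto

definition ell2_prod :: "nat \<Rightarrow> (nat \<Rightarrow> 'g::zero ell2) \<Rightarrow> (nat \<Rightarrow>\<^sub>0 'g) ell2" where
  "ell2_prod n \<psi> = Abs_ell2 (\<lambda>x. if x \<in> supp_below n then \<Prod>i<n. ell2_fun (\<psi> i) (Poly_Mapping.lookup x i) else 0)"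

lemma ell2_fun_prod:
  "ell2_fun (ell2_prod n \<psi>) x =
     (if x \<in> supp_below n then \<Prod>i<n. ell2_fun (\<psi> i) (Poly_Mapping.lookup x i) else 0)"
proof -
  let ?F = "\<lambda>x. if x \<in> supp_below n then \<Prod>i<n. ell2_fun (\<psi> i) (Poly_Mapping.lookup x i) else 0"
  let ?r = "\<lambda>x. restrict (Poly_Mapping.lookup x) {..<n}"
  have "(\<lambda>g. \<Prod>i<n. (cmod (ell2_fun (\<psi> i) (g i)))\<^sup>2) summable_on (PiE {..<n} (\<lambda>_. UNIV))"
    by (rule summable_on_prod_PiE) (auto simp: ell2_summable)
  hence "(\<lambda>x. \<Prod>i<n. (cmod (ell2_fun (\<psi> i) (?r x i)))\<^sup>2) summable_on supp_below n"
    by (subst summable_on_reindex_bij_betw[OF bij_betw_supp_below,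
          of "\<lambda>g. \<Prod>i<n. (cmod (ell2_fun (\<psi> i) (g i)))\<^sup>2"])
  also have "?this \<longleftrightarrow> (\<lambda>x. (cmod (?F x))\<^sup>2) summable_on UNIV"
    by (rule summable_on_cong_neutral) (auto simp: prod_norm[symmetric] prod_power_distrib)
  finally show ?thesis by (simp add: ell2_prod_def Abs_ell2_inverse)
qed

lemma cinner_ell2_prod: "cinner (ell2_prod n \<psi>) (ell2_prod n \<eta>) = (\<Prod>i<n. cinner (\<psi> i) (\<eta> i))"
proof -
  let ?r = "\<lambda>x. restrict (Poly_Mapping.lookup x) {..<n}"
  define f where "f i x = cnj (ell2_fun (\<psi> i) x) * ell2_fun (\<eta> i) x" for i x
  have "cinner (ell2_prod n \<psi>) (ell2_prod n \<eta>) = (\<Sum>\<^sub>\<infinity>x\<in>supp_below n. \<Prod>i<n. f i (?r x i))"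
    unfolding cinner_ell2_def
    by (rule infsum_cong_neutral) (auto simp: ell2_fun_prod f_def prod.distrib)
  also have "\<dots> = (\<Sum>\<^sub>\<infinity>g\<in>PiE {..<n} (\<lambda>_. UNIV). \<Prod>i<n. f i (g i))"
    by (rule infsum_reindex_bij_betw[OF bij_betw_supp_below, of "\<lambda>g. \<Prod>i<n. f i (g i)"])
  also have "\<dots> = (\<Prod>i<n. \<Sum>\<^sub>\<infinity>x. f i x)"
  proof (rule infsum_prod_PiE_abs)
    show "(\<lambda>x. norm (f i x)) summable_on UNIV" for i
      unfolding f_def
      using ell2_cnj_mult_summable[of "\<psi> i" "\<eta> i"]
      by (simp add: summable_on_iff_abs_summable_on_complex)
  qed simp
  finally show ?thesis by (simp add: cinner_ell2_def f_def)
qed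

lemma norm_chi_single: "norm (chi {x}) = 1"
proof -
  have "(norm (chi {x}))\<^sup>2 = (\<Sum>\<^sub>\<infinity>y\<in>{x}. 1)"
    unfolding norm_ell2_squared
    by (rule infsum_cong_neutral) (auto simp: ell2_fun_chi indicator_def)
  hence "(norm (chi {x}))\<^sup>2 = 1\<^sup>2" by simp
  thus ?thesis by (rule power2_eq_imp_eq) auto
qed

lemma ell2_finite_approx:
  assumes "e > 0"
  obtains F where "finite F" "dist (\<Sum>x\<in>F. ell2_fun f x *\<^sub>C chi {x}) f < e"
proof -
  let ?q = "\<lambda>x. (cmod (ell2_fun f x))\<^sup>2"
  have "(sum ?q \<longlongrightarrow> infsum ?q UNIV) (finite_subsets_at_top UNIV)"
    by (rule infsum_tendsto[OF ell2_summable])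
  hence "eventually (\<lambda>F. dist (sum ?q F) (infsum ?q UNIV) < e\<^sup>2) (finite_subsets_at_top UNIV)"
    using \<open>e > 0\<close> by (intro tendstoD) auto
  then obtain F where F: "finite F" "dist (sum ?q F) (infsum ?q UNIV) < e\<^sup>2"
    unfolding eventually_finite_subsets_at_top by auto
  define g where "g = (\<Sum>x\<in>F. ell2_fun f x *\<^sub>C chi {x})"
  have sum_fun: "ell2_fun (\<Sum>x\<in>A. h x) y = (\<Sum>x\<in>A. ell2_fun (h x) y)" if "finite A"
    for A and h :: "'a \<Rightarrow> 'a ell2" and y
    using that by induction (auto simp: zero_ell2.rep_eq plus_ell2.rep_eq)
  have g: "ell2_fun g y = (if y \<in> F then ell2_fun f y else 0)" for y
    using F(1) by (simp add: g_def sum_fun scaleC_ell2.rep_eq ell2_fun_chi indicator_def)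
  have "(norm (g - f))\<^sup>2 = infsum ?q (UNIV - F)"
    unfolding norm_ell2_squared
    by (rule infsum_cong_neutral) (auto simp: minus_ell2.rep_eq g)
  also have "\<dots> = infsum ?q UNIV - infsum ?q F"
    by (rule infsum_Diff) (use F(1) in \<open>auto simp: ell2_summable\<close>)
  also have "\<dots> < e\<^sup>2"
    using F by (simp add: dist_real_def)
  finally have "norm (g - f) < e"
    by (rule power_less_imp_less_base) (use \<open>e > 0\<close> in simp)
  thus ?thesis using F(1) that[of F] by (simp add: g_def dist_norm)
qed

lemma infinite_tensor_product_exists:
  fixes \<phi> :: "nat \<Rightarrow> 'g::zero ell2"
  assumes "\<And>n. norm (\<phi> n) = 1"
  shows "\<exists>tens :: nat \<Rightarrow> (nat \<Rightarrow> 'g ell2) \<Rightarrow> (nat \<Rightarrow>\<^sub>0 'g) ell2. infinite_tensor_product \<phi> tens"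
proof -
  have "\<exists>W. (\<forall>x y. W (x + y) = W x + W y) \<and> (\<forall>c x. W (c *\<^sub>C x) = c *\<^sub>C W x) \<and>
      (\<forall>x y. cinner (W x) (W y) = cinner x y) \<and> surj W \<and> W (\<phi> i) = chi {0::'g}" for i
    by (rule exists_unitary[OF assms norm_chi_single])
  hence "\<exists>W. \<forall>i. (\<forall>x y. W i (x + y) = W i x + W i y) \<and> (\<forall>c x. W i (c *\<^sub>C x) = c *\<^sub>C W i x) \<and>
      (\<forall>x y. cinner (W i x) (W i y) = cinner x y) \<and> surj (W i) \<and> W i (\<phi> i) = chi {0::'g}"
    by (intro choice allI)
  then obtain W where W: "\<And>i x y. W i (x + y) = W i x + W i y" "\<And>i c x. W i (c *\<^sub>C x) = c *\<^sub>C W i x"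
    "\<And>i x y. cinner (W i x) (W i y) = cinner x y" "\<And>i. surj (W i)" "\<And>i. W i (\<phi> i) = chi {0::'g}"
    by blast
  define tens where "tens n \<psi> = ell2_prod n (\<lambda>i. W i (\<psi> i))" for n \<psi>
  have upd: "(\<Prod>j<n. ell2_fun (W j ((\<psi>(i := v)) j)) (Poly_Mapping.lookup x j)) =
      ell2_fun (W i v) (Poly_Mapping.lookup x i) * (\<Prod>j\<in>{..<n} - {i}. ell2_fun (W j (\<psi> j)) (Poly_Mapping.lookup x j))"
    if "i < n" for n i \<psi> v x
    using that by (subst prod.remove[of _ i]) (auto intro!: prod.cong)
  have "infinite_tensor_product \<phi> tens"
  proof (rule infinite_tensor_product.intro)
    show "norm (\<phi> n) = 1" for n by (rule assms)
    show "hilbert_tensor {..<n} (tens n)" for n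
    proof
      show "tens n \<psi> = tens n \<eta>" if "\<And>i. i \<in> {..<n} \<Longrightarrow> \<psi> i = \<eta> i" for \<psi> \<eta>
      proof (rule ell2_eqI)
        fix x :: "nat \<Rightarrow>\<^sub>0 'g"
        have "(\<Prod>i<n. ell2_fun (W i (\<psi> i)) (Poly_Mapping.lookup x i))
            = (\<Prod>i<n. ell2_fun (W i (\<eta> i)) (Poly_Mapping.lookup x i))"
          by (rule prod.cong) (simp_all add: that)
        thus "ell2_fun (tens n \<psi>) x = ell2_fun (tens n \<eta>) x"
          by (simp only: tens_def ell2_fun_prod)
      qed
      show "tens n (\<psi>(i := v + w)) = tens n (\<psi>(i := v)) + tens n (\<psi>(i := w))"
        if "i \<in> {..<n}" for \<psi> i v w
        by (rule ell2_eqI)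
          (use that in \<open>simp add: tens_def ell2_fun_prod upd plus_ell2.rep_eq W distrib_right
              del: fun_upd_apply\<close>)
      show "tens n (\<psi>(i := c *\<^sub>C v)) = c *\<^sub>C tens n (\<psi>(i := v))"
        if "i \<in> {..<n}" for \<psi> i v c
        by (rule ell2_eqI)
          (use that in \<open>simp add: tens_def ell2_fun_prod upd scaleC_ell2.rep_eq W mult.assoc
              del: fun_upd_apply\<close>)
      show "cinner (tens n \<psi>) (tens n \<eta>) = (\<Prod>i\<in>{..<n}. cinner (\<psi> i) (\<eta> i))" for \<psi> \<eta>
        by (simp add: tens_def cinner_ell2_prod W)
    qed
    show "tens (Suc n) (\<psi>(n := \<phi> n)) = tens n \<psi>" for n \<psi>
    proof (rule ell2_eqI)
      fix x :: "nat \<Rightarrow>\<^sub>0 'g"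
      have supp: "x \<in> supp_below n \<longleftrightarrow> x \<in> supp_below (Suc n) \<and> Poly_Mapping.lookup x n = 0"
        unfolding supp_below_def mem_Collect_eq by (metis Suc_leD le_refl not_less_eq_eq le_antisym)
      have "(\<Prod>i<n. ell2_fun (W i ((\<psi>(n := \<phi> n)) i)) (Poly_Mapping.lookup x i))
          = (\<Prod>i<n. ell2_fun (W i (\<psi> i)) (Poly_Mapping.lookup x i))"
        by (rule prod.cong) auto
      thus "ell2_fun (tens (Suc n) (\<psi>(n := \<phi> n))) x = ell2_fun (tens n \<psi>) x"
        by (simp add: tens_def ell2_fun_prod W ell2_fun_chi supp)
    qed
    have delta: "chi {x} \<in> range (tens n)" if "x \<in> supp_below n" for n x
    proof
      let ?\<psi> = "\<lambda>i. inv (W i) (chi {Poly_Mapping.lookup x i})"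
      have W_inv: "W i (inv (W i) y) = y" for i y
        using W(4) by (rule surj_f_inv_f)
      show "chi {x} = tens n ?\<psi>"
      proof (rule ell2_eqI)
        fix y :: "nat \<Rightarrow>\<^sub>0 'g"
        show "ell2_fun (chi {x}) y = ell2_fun (tens n ?\<psi>) y"
        proof (cases "y = x")
          case True
          thus ?thesis using that by (simp add: tens_def ell2_fun_prod W_inv ell2_fun_chi)
        next
          case False
          then obtain j where j: "Poly_Mapping.lookup y j \<noteq> Poly_Mapping.lookup x j"
            by (auto simp: poly_mapping_eq_iff fun_eq_iff)
          have "(\<Prod>i<n. ell2_fun (chi {Poly_Mapping.lookup x i}) (Poly_Mapping.lookup y i)) = 0"
            if "y \<in> supp_below n"
          proof (rule prod_zero)
            have "j < n"
              using j that \<open>x \<in> supp_below n\<close> unfolding supp_below_def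
              by (metis (mono_tags, lifting) mem_Collect_eq not_le)
            thus "\<exists>i\<in>{..<n}. ell2_fun (chi {Poly_Mapping.lookup x i}) (Poly_Mapping.lookup y i) = 0"
              using j by (intro bexI[of _ j]) (auto simp: ell2_fun_chi)
          qed simp
          thus ?thesis using False by (simp add: tens_def ell2_fun_prod W_inv ell2_fun_chi)
        qed
      qed
    qed simp
    have supp_ex: "\<exists>n. x \<in> supp_below n" for x :: "nat \<Rightarrow>\<^sub>0 'g"
    proof -
      obtain n where "Poly_Mapping.keys x \<subseteq> {..<n}" using finite_nat_bounded[OF finite_keys] by blast
      hence "x \<in> supp_below n"
        unfolding supp_below_def in_keys_iff subset_iff lessThan_iff mem_Collect_eq
        by (metis not_less)
      thus ?thesis ..
    qed
    show "closure (\<Union>n. hilbert_tensor_space (tens n)) = UNIV"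
    proof -
      have "f \<in> closure (\<Union>n. hilbert_tensor_space (tens n))" for f
        unfolding closure_approachable
      proof (intro allI impI)
        fix e :: real assume "e > 0"
        then obtain F where F: "finite F" "dist (\<Sum>x\<in>F. ell2_fun f x *\<^sub>C chi {x}) f < e"
          by (rule ell2_finite_approx)
        obtain N where N: "\<And>x :: nat \<Rightarrow>\<^sub>0 'g. x \<in> supp_below (N x)" using supp_ex by metis
        define n where "n = Max (insert 0 (N ` F))"
        have "x \<in> supp_below n" if "x \<in> F" for x
        proof -
          have "N x \<le> n" unfolding n_def using that F(1) by (intro Max_ge) auto
          thus ?thesis using N[of x] by (auto simp: supp_below_def)
        qed
        hence "(\<Sum>x\<in>F. ell2_fun f x *\<^sub>C chi {x}) \<in> cspan (range (tens n))"
          by (intro complex_vector.span_sum complex_vector.span_scale complex_vector.span_base delta)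
        hence "(\<Sum>x\<in>F. ell2_fun f x *\<^sub>C chi {x}) \<in> hilbert_tensor_space (tens n)"
          unfolding hilbert_tensor_space_def using closure_subset by blast
        thus "\<exists>y\<in>\<Union>n. hilbert_tensor_space (tens n). dist y f < e"
          using F(2) by blast
      qed
      thus ?thesis by blast
    qed
  qed
  thus ?thesis by blast
qed

end

theory Submission
  imports Defs
begin

text \<open>
  An operator that acts as a unitary \<open>T i\<close> in finitely many factors is determined by its
  inner-product-preserving values on the total set of elementary tensors. On a vector that is
  \<open>\<phi> i\<close> in almost all factors, two such operators agreeing on the first factors differ by an amount
  controlled by \<open>1 - \<Prod>i. z i\<close> over finitely many late \<open>i\<close> (some \<open>z i\<close> conjugated), where \<open>z i = \<langle>\<phi> i, T i (\<phi> i)\<rangle>\<close>; hence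
  summability of \<open>\<bar>1 - z i\<bar>\<close> makes the net strongly Cauchy. For \<open>T i = U i x\<close> the number \<open>z i\<close> is the average
  over \<open>y \<in> F i\<close> of \<open>u i (- y) x\<close> if \<open>y \<in> x + F i\<close> and of \<open>0\<close> otherwise, so the two summability
  hypotheses bound \<open>\<bar>1 - z i\<bar>\<close>.
\<close>

section \<open>Extending an isometry from a total family\<close>

text \<open>
  The graph of the would-be linear map sending \<open>a i\<close> to \<open>b i\<close>; it is single-valued when \<open>a\<close> and \<open>b\<close>
  have the same Gram matrix.
\<close>

inductive lincomb_rel :: "('i \<Rightarrow> 'h::complex_inner) \<Rightarrow> ('i \<Rightarrow> 'k::complex_inner) \<Rightarrow> 'h \<Rightarrow> 'k \<Rightarrow> bool"
  for a b where
  zero: "lincomb_rel a b 0 0"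
| step: "lincomb_rel a b x y \<Longrightarrow> lincomb_rel a b (c *\<^sub>C a i + x) (c *\<^sub>C b i + y)"

lemma lincomb_rel_base: "lincomb_rel a b (a i) (b i)"
  using lincomb_rel.step[OF lincomb_rel.zero, of a b 1 i] by simp

lemma lincomb_rel_add:
  assumes "lincomb_rel a b x y" "lincomb_rel a b x' y'"
  shows "lincomb_rel a b (x + x') (y + y')"
  using assms(1)
  by induction (auto simp: assms(2) add.assoc intro: lincomb_rel.intros)

lemma lincomb_rel_scaleC:
  assumes "lincomb_rel a b x y"
  shows "lincomb_rel a b (c *\<^sub>C x) (c *\<^sub>C y)"
  using assms
  by induction (auto simp: scaleC_add_right scaleC_scaleC intro: lincomb_rel.intros)

lemma lincomb_rel_total:
  assumes "x \<in> cspan (range a)"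
  shows "\<exists>y. lincomb_rel a b x y"
  using assms
proof (induction rule: complex_vector.span_induct_alt)
  case base
  show ?case using lincomb_rel.zero by blast
next
  case (step c x y)
  thus ?case by (auto intro: lincomb_rel.step)
qed

lemma cinner_zero [simp]: "cinner 0 x = 0" "cinner x 0 = 0" for x :: "'a::complex_inner"
  using cinner_add_left[of 0 0 x] cinner_add_right[of x 0 0] by simp_all

text \<open>Sesquilinearity reduces the claim to the Gram matrices, one argument at a time: first
  \<open>b i\<close> is paired with a general \<open>y'\<close>, then the left vector is built
  up.\<close>

lemma lincomb_rel_cinner:
  assumes ab: "\<And>i j. cinner (b i) (b j) = cinner (a i) (a j)"
    and "lincomb_rel a b x y" "lincomb_rel a b x' y'"
  shows "cinner y y' = cinner x x'"
proof -
  have *: "cinner (b i) y' = cinner (a i) x'" for i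
    using assms(3) by induction (auto simp: cinner_add_right cinner_scaleC_right ab)
  show ?thesis
    using assms(2) by induction (auto simp: cinner_add_left cinner_scaleC_left *)
qed

lemma norm_eq_if_cinner_eq:
  assumes "cinner x x = cinner y y"
  shows "norm x = norm y"
proof -
  have "(norm x)\<^sup>2 = (norm y)\<^sup>2"
    using assms unfolding cinner_self by (simp only: of_real_eq_iff)
  thus ?thesis by (rule power2_eq_imp_eq) auto
qed

lemma bounded_linear_scaleC: "bounded_linear (\<lambda>x::'a::complex_inner. c *\<^sub>C x)"
  by (intro bounded_linear_intro[where K = "cmod c"])
    (simp_all add: scaleC_add_right norm_scaleC scaleC_scaleC mult.commute flip: scaleC_of_real)

lemma bounded_clinear_isometryI:
  assumes "\<And>x y. S (x + y) = S x + S y" "\<And>c x. S (c *\<^sub>C x) = c *\<^sub>C S x" "\<And>x. norm (S x) = norm x"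
  shows "bounded_clinear S"
  unfolding bounded_clinear_def
proof
  show "bounded_linear S"
  proof (rule bounded_linear_intro)
    show "S (r *\<^sub>R x) = r *\<^sub>R S x" for r x
      using assms(2)[of "complex_of_real r" x] by (simp only: scaleC_of_real)
    show "norm (S x) \<le> norm x * 1" for x by (simp add: assms(3))
  qed (rule assms(1))
qed (simp add: assms(2))

text \<open>Equal Gram matrices make \<open>a i\<close> \<mapsto> \<open>b i\<close> a well-defined
  linear isometry on the span. An isometry into a complete space is uniformly continuous, so it
  extends to the closure, and its algebraic identities extend with it.\<close>

lemma isometry_extension:
  fixes a :: "'i \<Rightarrow> 'h::chilbert_space" and b :: "'i \<Rightarrow> 'k::chilbert_space"
  assumes ab: "\<And>i j. cinner (b i) (b j) = cinner (a i) (a j)"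
    and dense: "closure (cspan (range a)) = UNIV"
  obtains S where "bounded_clinear S" "\<And>v. norm (S v) = norm v" "\<And>i. S (a i) = b i"
proof -
  let ?W = "cspan (range a)"
  have unique: "y = y'" if "lincomb_rel a b x y" "lincomb_rel a b x y'" for x y y'
  proof -
    \<comment> \<open>The difference of two images of \<open>x\<close> is an image of 0, hence has
      the norm of 0.\<close>
    have L: "lincomb_rel a b 0 (y - y')"
      using lincomb_rel_add[OF that(1) lincomb_rel_scaleC[OF that(2), of "-1"]]
      by (simp add: complex_vector.scale_minus_left)
    have "cinner (y - y') (y - y') = cinner (0::'h) 0"
      by (rule lincomb_rel_cinner[of b a, OF ab L L])
    hence "norm (y - y') = norm (0::'h)" by (simp add: cinner_self)
    thus ?thesis by simp
  qed
  define f where "f x = (SOME y. lincomb_rel a b x y)" for x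
  have f: "lincomb_rel a b x (f x)" if "x \<in> ?W" for x
    unfolding f_def by (rule someI_ex[OF lincomb_rel_total[OF that]])
  have f_add: "f (x + y) = f x + f y" if "x \<in> ?W" "y \<in> ?W" for x y
    by (rule unique[OF f[OF complex_vector.span_add[OF that]] lincomb_rel_add[OF f f]]) (use that in auto)
  have f_scale: "f (c *\<^sub>C x) = c *\<^sub>C f x" if "x \<in> ?W" for c x
    by (rule unique[OF f[OF complex_vector.span_scale[OF that]] lincomb_rel_scaleC[OF f[OF that]]])
  have f_norm: "norm (f x) = norm x" if "x \<in> ?W" for x
    by (rule norm_eq_if_cinner_eq[OF lincomb_rel_cinner[of b a, OF ab f f]]) (use that in auto)
  have f_dist: "dist (f x) (f y) = dist x y" if "x \<in> ?W" "y \<in> ?W" for x y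
  proof -
    have "f ((x - y) + y) = f (x - y) + f y"
      by (rule f_add[OF complex_vector.span_diff[OF that] that(2)])
    hence "f x - f y = f (x - y)" by simp
    thus ?thesis
      by (simp add: dist_norm f_norm complex_vector.span_diff that)
  qed
  have "uniformly_continuous_on ?W f"
    unfolding uniformly_continuous_on_def using f_dist by auto
  then obtain S where ucont: "uniformly_continuous_on (closure ?W) S" and Sf: "\<And>x. x \<in> ?W \<Longrightarrow> f x = S x"
    by (rule uniformly_continuous_on_extension_on_closure) metis
  have cont: "continuous_on UNIV S"
    using uniformly_continuous_imp_continuous[OF ucont] unfolding dense .
  \<comment> \<open>These rules let \<open>continuous_intros\<close> show that the identities below
    define closed sets; each set contains the dense span, or its square in the case of
    additivity.\<close>
  note [continuous_intros] = continuous_on_compose2[OF cont _ subset_UNIV]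
  note [continuous_intros] =
    continuous_on_compose2[OF linear_continuous_on[OF bounded_linear_scaleC] _ subset_UNIV]
  have S_add: "S (x + y) = S x + S y" for x y
  proof -
    let ?A = "{p. S (fst p + snd p) = S (fst p) + S (snd p)}"
    have "closure (?W \<times> ?W) \<subseteq> ?A"
    proof (rule closure_minimal)
      show "?W \<times> ?W \<subseteq> ?A"
        by (auto simp: f_add complex_vector.span_add simp flip: Sf)
    qed (intro closed_Collect_eq continuous_intros)
    hence "(x, y) \<in> ?A" unfolding closure_Times dense by blast
    thus ?thesis by simp
  qed
  have S_scale: "S (c *\<^sub>C x) = c *\<^sub>C S x" for c x
  proof -
    have "closure ?W \<subseteq> {x. S (c *\<^sub>C x) = c *\<^sub>C S x}"
    proof (rule closure_minimal)
      show "?W \<subseteq> {x. S (c *\<^sub>C x) = c *\<^sub>C S x}"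
        by (auto simp: f_scale complex_vector.span_scale simp flip: Sf)
    qed (intro closed_Collect_eq continuous_intros)
    thus ?thesis unfolding dense by auto
  qed
  have S_norm: "norm (S x) = norm x" for x
  proof -
    have "closure ?W \<subseteq> {x. norm (S x) = norm x}"
    proof (rule closure_minimal)
      show "?W \<subseteq> {x. norm (S x) = norm x}"
        by (auto simp: f_norm simp flip: Sf)
    qed (intro closed_Collect_eq continuous_intros)
    thus ?thesis unfolding dense by auto
  qed
  have "bounded_clinear S"
    by (rule bounded_clinear_isometryI) (fact S_add S_scale S_norm)+
  moreover have "S (a i) = b i" for i
  proof -
    have "a i \<in> ?W" by (rule complex_vector.span_base) simp
    thus ?thesis using unique[OF f lincomb_rel_base] Sf by metis
  qed
  ultimately show ?thesis
    using that[of S] S_norm by blast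
qed

section \<open>Limits of isometries and the complex Cauchy-Schwarz inequality\<close>

text \<open>Norm preservation passes to the pointwise limit, so boundedness comes without the
  uniform boundedness principle.\<close>

lemma bounded_clinear_pointwise_limit:
  fixes R :: "nat \<Rightarrow> 'h::complex_inner \<Rightarrow> 'k::complex_inner"
  assumes R: "\<And>m. bounded_clinear (R m)" "\<And>m v. norm (R m v) = norm v"
    and lim: "\<And>v. (\<lambda>m. R m v) \<longlonglongrightarrow> S v"
  shows "bounded_clinear S"
proof -
  have lin: "R m (v + w) = R m v + R m w" "R m (c *\<^sub>C v) = c *\<^sub>C R m v" for m v w c
    using R(1)[of m] by (auto simp: bounded_clinear_def linear_add bounded_linear.linear)
  have add: "S (v + w) = S v + S w" for v w
    using LIMSEQ_unique[OF lim[of "v + w", unfolded lin] tendsto_add[OF lim lim]] .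
  have scale: "S (c *\<^sub>C v) = c *\<^sub>C S v" for c v
    using LIMSEQ_unique[OF lim[of "c *\<^sub>C v", unfolded lin] bounded_linear.tendsto[OF bounded_linear_scaleC lim]] .
  have norm: "norm (S v) = norm v" for v
    using tendsto_norm[OF lim[of v]] unfolding R(2) by (simp add: LIMSEQ_const_iff)
  show ?thesis
    by (rule bounded_clinear_isometryI) (fact add scale norm)+
qed

text \<open>The real Cauchy-Schwarz inequality only controls the real part. Replacing
  \<open>x\<close> by \<open>cinner x y *\<^sub>C x\<close> makes the inner product real, namely the
  squared modulus.\<close>

lemma cmod_cinner_le: "cmod (cinner x y) \<le> norm x * norm (y::'a::complex_inner)"
proof (cases "cinner x y = 0")
  case False
  let ?z = "cinner x y"
  have "(cmod ?z)\<^sup>2 = Re (cinner (?z *\<^sub>C x) y)"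
    by (simp add: cinner_scaleC_left mult.commute[of "cnj ?z"] flip: complex_norm_square)
  also have "\<dots> \<le> norm (?z *\<^sub>C x) * norm y"
    unfolding Re_cinner by (rule norm_cauchy_schwarz)
  finally have "cmod ?z * cmod ?z \<le> cmod ?z * (norm x * norm y)"
    by (simp add: norm_scaleC power2_eq_square mult.assoc)
  thus ?thesis using False by simp
qed simp

section \<open>Operators acting on finitely many tensor factors, and their limit\<close>

context infinite_tensor_product
begin

text \<open>Restricting to stages at least \<open>k\<close> loses nothing, since padding with
  \<open>\<phi>\<close> moves every elementary tensor to a later stage. This allows \<open>k\<close>
  to be chosen beyond all factors in \<open>J\<close>.\<close>

lemma closure_cspan_elementary:
  "closure (cspan (range (\<lambda>(n, \<psi>). tens (max n k) \<psi>))) = UNIV"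
proof -
  let ?a = "\<lambda>(n, \<psi>). tens (max n k) \<psi>"
  have "tens n \<psi> \<in> range ?a" for n \<psi>
  proof
    show "tens n \<psi> = ?a (n, \<lambda>i. if i < n then \<psi> i else \<phi> i)"
      using tens_extend[of n "max n k" \<psi>] by simp
  qed simp
  hence "hilbert_tensor_space (tens n) \<subseteq> closure (cspan (range ?a))" for n
    unfolding hilbert_tensor_space_def
    by (intro closure_mono complex_vector.span_mono) auto
  hence "closure (\<Union>n. hilbert_tensor_space (tens n)) \<subseteq> closure (cspan (range ?a))"
    by (intro closure_minimal) auto
  thus ?thesis using dense by auto
qed

lemma cinner_tens:
  assumes "m \<le> N" "n \<le> N"
  shows "cinner (tens m \<psi>) (tens n \<eta>)
    = (\<Prod>i<N. cinner (if i < m then \<psi> i else \<phi> i) (if i < n then \<eta> i else \<phi> i))"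
  using tens_extend[OF assms(1), of \<psi>] tens_extend[OF assms(2), of \<eta>]
  by (simp add: hilbert_tensor.cinner[OF tensor])

text \<open>Inner products of elementary tensors are products over the factors, so applying
  isometries factorwise preserves the Gram matrix and \<open>isometry_extension\<close>
  applies.\<close>

lemma factor_isometry_exists:
  assumes T: "\<And>i v w. cinner (T i v) (T i w) = cinner v w" and "finite J"
  shows "\<exists>S. acts_on_factors tens T J S \<and> (\<forall>v. norm (S v) = norm v)"
proof -
  let ?T = "\<lambda>\<psi> i. if i \<in> J then T i (\<psi> i) else \<psi> i"
  obtain k where k: "J \<subseteq> {..<k}"
    using finite_nat_bounded[OF \<open>finite J\<close>] by auto
  let ?a = "\<lambda>(n, \<psi>). tens (max n k) \<psi>" and ?b = "\<lambda>(n, \<psi>). tens (max n k) (?T \<psi>)"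
  have "cinner (?b p) (?b q) = cinner (?a p) (?a q)" for p q
  proof -
    obtain m \<psi> n \<eta> where pq: "p = (m, \<psi>)" "q = (n, \<eta>)" by fastforce
    define N where "N = max (max m k) (max n k)"
    have N: "max m k \<le> N" "max n k \<le> N" by (simp_all add: N_def)
    \<comment> \<open>An index in \<open>J\<close> lies below both stages, so no padding interferes
      and \<open>T i\<close> acts on both sides of the inner product; at other indices nothing
      changes.\<close>
    have "cinner (if i < max m k then ?T \<psi> i else \<phi> i) (if i < max n k then ?T \<eta> i else \<phi> i)
        = cinner (if i < max m k then \<psi> i else \<phi> i) (if i < max n k then \<eta> i else \<phi> i)" for i
    proof (cases "i \<in> J")
      case True
      hence "i < max m k" "i < max n k" using k by auto
      thus ?thesis using True by (simp add: T)
    qed (simp only: if_False)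
    thus ?thesis
      unfolding pq prod.case cinner_tens[OF N] by (intro prod.cong refl)
  qed
  then obtain S where S: "bounded_clinear S" "\<And>v. norm (S v) = norm v" "\<And>p. S (?a p) = ?b p"
    using isometry_extension[of ?b ?a, OF _ closure_cspan_elementary] by blast
  \<comment> \<open>The construction fixes \<open>S\<close> only at stages at least
    \<open>k\<close>, while \<open>n\<close> may be smaller: the vector is padded up to stage
    \<open>max n k\<close> and brought back afterwards. As \<open>J\<close> lies below
    \<open>n\<close>, the padding is left untouched.\<close>
  have "S (tens n \<psi>) = tens n (?T \<psi>)" if "J \<subseteq> {..<n}" for n \<psi>
  proof -
    let ?N = "max n k" and ?\<psi> = "\<lambda>i. if i < n then \<psi> i else \<phi> i"
    have "S (tens n \<psi>) = S (?a (?N, ?\<psi>))"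
      using tens_extend[of n ?N \<psi>] by simp
    also have "\<dots> = tens ?N (?T ?\<psi>)"
      unfolding S(3) by simp
    also have "?T ?\<psi> = (\<lambda>i. if i < n then ?T \<psi> i else \<phi> i)"
      using that by (auto simp: fun_eq_iff)
    also have "tens ?N \<dots> = tens n (?T \<psi>)"
      by (rule tens_extend[symmetric]) simp
    finally show ?thesis .
  qed
  thus ?thesis using S(1,2) unfolding acts_on_factors_def by blast
qed

text \<open>Both images have the norm of the vector, so their squared distance is governed by the
  real part of their inner product. That is the squared norm times a product over the late factors,
  where only those in exactly one of \<open>J\<close> and \<open>J'\<close> can differ from
  1.\<close>

lemma factor_isometries_tail_estimate:
  assumes T: "\<And>i v w. cinner (T i v) (T i w) = cinner v w"
    and S: "acts_on_factors tens T J S" "acts_on_factors tens T J' S'"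
    and J: "{..<M} \<subseteq> J" "{..<M} \<subseteq> J'" "J \<subseteq> {..<N}" "J' \<subseteq> {..<N}" and "n \<le> M" "M \<le> N"
  shows "(norm (S (tens n \<psi>) - S' (tens n \<psi>)))\<^sup>2
    \<le> 2 * (norm (tens n \<psi>))\<^sup>2 * (\<Sum>i=M..<N. cmod (1 - cinner (\<phi> i) (T i (\<phi> i))))"
proof -
  let ?v = "tens n \<psi>"
  define \<eta> where "\<eta> = (\<lambda>i. if i < n then \<psi> i else \<phi> i)"
  let ?T = "\<lambda>J i. if i \<in> J then T i (\<eta> i) else \<eta> i"
  define p where "p i = cinner (?T J i) (?T J' i)" for i
  have v: "?v = tens m \<eta>" if "n \<le> m" for m
    using tens_extend[OF that, of \<psi>] by (simp add: \<eta>_def)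
  have Sv: "S ?v = tens N (?T J)" "S' ?v = tens N (?T J')"
    using S J(3,4) \<open>n \<le> M\<close> \<open>M \<le> N\<close> v[of N] by (auto simp: acts_on_factors_def)
  have unit1: "cinner (\<phi> i) (\<phi> i) = 1" for i
    by (simp add: cinner_self unit)
  have T_norm: "norm (T i w) = norm w" for i w
    by (rule norm_eq_if_cinner_eq) (rule T)
  have norms: "cinner (S ?v) (S ?v) = cinner ?v ?v" "cinner (S' ?v) (S' ?v) = cinner ?v ?v"
    unfolding Sv unfolding v[OF order.trans[OF \<open>n \<le> M\<close> \<open>M \<le> N\<close>]] hilbert_tensor.cinner[OF tensor]
    by (auto simp: T intro!: prod.cong)
  define P where "P = (\<Prod>i=M..<N. p i)"
  have "cinner (S ?v) (S' ?v) = (\<Prod>i<N. p i)"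
    unfolding Sv hilbert_tensor.cinner[OF tensor] p_def ..
  also have "{..<N} = {..<M} \<union> {M..<N}"
    using \<open>M \<le> N\<close> by auto
  also have "(\<Prod>i\<in>\<dots>. p i) = (\<Prod>i<M. p i) * P"
    unfolding P_def by (rule prod.union_disjoint) auto
  \<comment> \<open>Below \<open>M\<close> both operators apply the same isometry
    \<open>T i\<close>, which cancels.\<close>
  also have "(\<Prod>i<M. p i) = (\<Prod>i<M. cinner (\<eta> i) (\<eta> i))"
    by (rule prod.cong) (use J(1,2) in \<open>auto simp: p_def T\<close>)
  also have "\<dots> = complex_of_real ((norm ?v)\<^sup>2)"
    unfolding v[OF \<open>n \<le> M\<close>] cinner_self[symmetric] hilbert_tensor.cinner[OF tensor] ..
  finally have SS': "inner (S ?v) (S' ?v) = (norm ?v)\<^sup>2 * Re P"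
    by (simp flip: Re_cinner)
  \<comment> \<open>Here \<open>p i\<close> is 1 if \<open>i\<close> lies in both or neither of
    \<open>J\<close> and \<open>J'\<close>; otherwise it is
    \<open>cinner (\<phi> i) (T i (\<phi> i))\<close> or its conjugate, equally far from 1.\<close>
  have p: "cmod (p i) \<le> 1 \<and> cmod (1 - p i) \<le> cmod (1 - cinner (\<phi> i) (T i (\<phi> i)))" if "i \<ge> M" for i
  proof -
    have \<eta>: "\<eta> i = \<phi> i" using that \<open>n \<le> M\<close> by (simp add: \<eta>_def)
    have "cmod (p i) \<le> norm (?T J i) * norm (?T J' i)"
      unfolding p_def by (rule cmod_cinner_le)
    also have "\<dots> = 1" by (simp add: \<eta> T_norm unit)
    finally have "cmod (p i) \<le> 1" .
    moreover have "cmod (1 - cinner (T i (\<phi> i)) (\<phi> i)) = cmod (1 - cinner (\<phi> i) (T i (\<phi> i)))"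
      by (subst cinner_commute, subst complex_mod_cnj[symmetric]) simp
    ultimately show ?thesis by (auto simp: p_def \<eta> T unit1)
  qed
  have "1 - Re P \<le> cmod (1 - P)"
    using complex_Re_le_cmod[of "1 - P"] by simp
  also have "\<dots> = cmod ((\<Prod>i=M..<N. 1) - (\<Prod>i=M..<N. p i))"
    by (simp add: P_def)
  \<comment> \<open>Products of numbers in the closed unit disc differ by at most the sum of the
    differences of their factors.\<close>
  also have "\<dots> \<le> (\<Sum>i=M..<N. cmod (1 - p i))"
    by (rule norm_prod_diff) (use p in auto)
  also have "\<dots> \<le> (\<Sum>i=M..<N. cmod (1 - cinner (\<phi> i) (T i (\<phi> i))))"
    by (rule sum_mono) (use p in auto)
  finally have P: "1 - Re P \<le> (\<Sum>i=M..<N. cmod (1 - cinner (\<phi> i) (T i (\<phi> i))))" .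
  have "(norm (S ?v - S' ?v))\<^sup>2 = (norm (S ?v))\<^sup>2 + (norm (S' ?v))\<^sup>2 - 2 * inner (S ?v) (S' ?v)"
    by (simp add: power2_norm_eq_inner inner_diff_left inner_diff_right inner_commute)
  also have "\<dots> = 2 * (norm ?v)\<^sup>2 * (1 - Re P)"
    unfolding SS' norms[THEN norm_eq_if_cinner_eq] by (simp add: algebra_simps)
  also have "\<dots> \<le> 2 * (norm ?v)\<^sup>2 * (\<Sum>i=M..<N. cmod (1 - cinner (\<phi> i) (T i (\<phi> i))))"
    by (intro mult_left_mono P) simp
  finally show ?thesis .
qed

text \<open>The tail estimate makes the net Cauchy on elementary tensors. Linearity carries this to
  their span, and norm preservation to all vectors. Completeness then gives a limit.\<close>

lemma tensor_operator_exists_if_summable: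
  assumes T: "\<And>i v w. cinner (T i v) (T i w) = cinner v w"
    and summable: "summable (\<lambda>i. cmod (1 - cinner (\<phi> i) (T i (\<phi> i))))"
  shows "tensor_operator_exists tens T"
proof -
  have "\<exists>S. finite J \<longrightarrow> acts_on_factors tens T J S \<and> (\<forall>v. norm (S v) = norm v)" for J
    using factor_isometry_exists[of T J, OF T] by (cases "finite J") simp_all
  then obtain R where "\<And>J. finite J \<longrightarrow> acts_on_factors tens T J (R J) \<and> (\<forall>v. norm (R J v) = norm v)"
    by metis
  hence R: "\<And>J. finite J \<Longrightarrow> acts_on_factors tens T J (R J)"
      "\<And>J v. finite J \<Longrightarrow> norm (R J v) = norm v"
    by blast+
  have R_clinear: "bounded_clinear (R J)" if "finite J" for J
    using R(1)[OF that] by (simp add: acts_on_factors_def)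
  have R_lin: "R J (v + w) = R J v + R J w" "R J (c *\<^sub>C v) = c *\<^sub>C R J v" if "finite J" for J v w c
    using R_clinear[OF that] by (auto simp: bounded_clinear_def linear_add bounded_linear.linear)
  have R_diff: "R J (v - w) = R J v - R J w" if "finite J" for J v w
    using R_lin(1)[OF that, of "v - w" w] by simp
  \<comment> \<open>The Cauchy condition for the net at \<open>v\<close>; initial segments suffice
    as thresholds because every finite set of naturals is contained in one.\<close>
  define net where "net v \<longleftrightarrow> (\<forall>e>0. \<exists>M. \<forall>J J'. finite J \<longrightarrow> finite J' \<longrightarrow> {..<M} \<subseteq> J \<longrightarrow> {..<M} \<subseteq> J' \<longrightarrow>
      dist (R J v) (R J' v) < e)" for v
  have net_tens: "net (tens n \<psi>)" for n \<psi>
    unfolding net_def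
  proof (intro allI impI)
    fix e :: real assume "e > 0"
    let ?v = "tens n \<psi>"
    \<comment> \<open>The summand 1 keeps the denominator positive when \<open>?v\<close> is
      zero.\<close>
    define d where "d = e\<^sup>2 / (2 * (norm ?v)\<^sup>2 + 1)"
    have pos: "2 * (norm ?v)\<^sup>2 + 1 > 0" by (simp add: add_nonneg_pos)
    hence "d > 0" using \<open>e > 0\<close> by (simp add: d_def)
    then obtain M where M: "\<And>m k. m \<ge> M \<Longrightarrow>
        norm (\<Sum>i=m..<k. cmod (1 - cinner (\<phi> i) (T i (\<phi> i)))) < d"
      using summable unfolding summable_Cauchy by blast
    \<comment> \<open>Beyond \<open>n\<close> the vector has entries \<open>\<phi> i\<close>, and
      beyond \<open>M\<close> the tail sums are below \<open>d\<close>; the threshold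
      \<open>max n M\<close> secures both.\<close>
    have "dist (R J ?v) (R J' ?v) < e"
      if J: "finite J" "finite J'" "{..<max n M} \<subseteq> J" "{..<max n M} \<subseteq> J'" for J J'
    proof -
      obtain N where N: "J \<union> J' \<subseteq> {..<N}"
        using finite_nat_bounded[of "J \<union> J'"] J by auto
      let ?s = "\<Sum>i=max n M..<max N (max n M). cmod (1 - cinner (\<phi> i) (T i (\<phi> i)))"
      have "(norm (R J ?v - R J' ?v))\<^sup>2 \<le> 2 * (norm ?v)\<^sup>2 * ?s"
        by (rule factor_isometries_tail_estimate[OF T R(1)[OF J(1)] R(1)[OF J(2)]])
          (use J N in auto)
      also have "\<dots> \<le> 2 * (norm ?v)\<^sup>2 * d"
        using M[of "max n M" "max N (max n M)"] by (intro mult_left_mono) auto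
      also have "\<dots> < (2 * (norm ?v)\<^sup>2 + 1) * d"
        using \<open>d > 0\<close> by (intro mult_strict_right_mono) auto
      also have "\<dots> = e\<^sup>2" using pos by (simp add: d_def)
      finally have "norm (R J ?v - R J' ?v) < e"
        by (rule power_less_imp_less_base) (use \<open>e > 0\<close> in simp)
      thus ?thesis by (simp add: dist_norm)
    qed
    thus "\<exists>M. \<forall>J J'. finite J \<longrightarrow> finite J' \<longrightarrow> {..<M} \<subseteq> J \<longrightarrow> {..<M} \<subseteq> J' \<longrightarrow>
        dist (R J ?v) (R J' ?v) < e"
      by blast
  qed
  have net_add: "net (v + w)" if "net v" "net w" for v w
    unfolding net_def
  proof (intro allI impI)
    fix e :: real assume "e > 0"
    hence "e / 2 > 0" by simp
    obtain M1 where M1: "\<And>J J'. finite J \<Longrightarrow> finite J' \<Longrightarrow> {..<M1} \<subseteq> J \<Longrightarrow> {..<M1} \<subseteq> J' \<Longrightarrow>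
        dist (R J v) (R J' v) < e / 2"
      using \<open>net v\<close> \<open>e / 2 > 0\<close> unfolding net_def by metis
    obtain M2 where M2: "\<And>J J'. finite J \<Longrightarrow> finite J' \<Longrightarrow> {..<M2} \<subseteq> J \<Longrightarrow> {..<M2} \<subseteq> J' \<Longrightarrow>
        dist (R J w) (R J' w) < e / 2"
      using \<open>net w\<close> \<open>e / 2 > 0\<close> unfolding net_def by metis
    have "dist (R J (v + w)) (R J' (v + w)) < e"
      if "finite J" "finite J'" "{..<max M1 M2} \<subseteq> J" "{..<max M1 M2} \<subseteq> J'" for J J'
    proof -
      have "{..<M1} \<subseteq> J" "{..<M1} \<subseteq> J'" "{..<M2} \<subseteq> J" "{..<M2} \<subseteq> J'" using that by auto
      thus ?thesis
        using M1[OF that(1,2)] M2[OF that(1,2)] that(1,2)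
          dist_triangle_add[of "R J v" "R J w" "R J' v" "R J' w"]
        by (simp add: R_lin)
    qed
    thus "\<exists>M. \<forall>J J'. finite J \<longrightarrow> finite J' \<longrightarrow> {..<M} \<subseteq> J \<longrightarrow> {..<M} \<subseteq> J' \<longrightarrow>
        dist (R J (v + w)) (R J' (v + w)) < e"
      by blast
  qed
  have net_scaleC: "net (c *\<^sub>C v)" if "net v" for c v
    unfolding net_def
  proof (intro allI impI)
    fix e :: real assume "e > 0"
    define d where "d = e / (cmod c + 1)"
    have "cmod c + 1 > 0" by (simp add: add_nonneg_pos)
    hence "d > 0" and e: "e = (cmod c + 1) * d" using \<open>e > 0\<close> by (simp_all add: d_def)
    obtain M where M: "\<And>J J'. finite J \<Longrightarrow> finite J' \<Longrightarrow> {..<M} \<subseteq> J \<Longrightarrow> {..<M} \<subseteq> J' \<Longrightarrow>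
        dist (R J v) (R J' v) < d"
      using \<open>net v\<close> \<open>d > 0\<close> unfolding net_def by metis
    have "dist (R J (c *\<^sub>C v)) (R J' (c *\<^sub>C v)) < e"
      if "finite J" "finite J'" "{..<M} \<subseteq> J" "{..<M} \<subseteq> J'" for J J'
    proof -
      have "dist (R J (c *\<^sub>C v)) (R J' (c *\<^sub>C v)) = cmod c * dist (R J v) (R J' v)"
        using that(1,2)
        by (simp add: R_lin dist_norm norm_scaleC flip: complex_vector.scale_right_diff_distrib)
      also have "\<dots> \<le> cmod c * d"
        using M[OF that] by (intro mult_left_mono) auto
      also have "\<dots> < e" using \<open>d > 0\<close> by (simp add: e distrib_right)
      finally show ?thesis .
    qed
    thus "\<exists>M. \<forall>J J'. finite J \<longrightarrow> finite J' \<longrightarrow> {..<M} \<subseteq> J \<longrightarrow> {..<M} \<subseteq> J' \<longrightarrow>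
        dist (R J (c *\<^sub>C v)) (R J' (c *\<^sub>C v)) < e"
      by blast
  qed
  have net_zero: "net 0"
    using net_scaleC[OF net_tens, of 0] by simp
  have net_span: "net v" if "v \<in> cspan (range (\<lambda>(n, \<psi>). tens (max n 0) \<psi>))" for v
    using that
    by (induction rule: complex_vector.span_induct_alt)
      (auto intro: net_zero net_add net_scaleC net_tens)
  have net: "net v" for v
    unfolding net_def
  proof (intro allI impI)
    fix e :: real assume "e > 0"
    hence "e / 3 > 0" by simp
    have "v \<in> closure (cspan (range (\<lambda>(n, \<psi>). tens (max n 0) \<psi>)))"
      unfolding closure_cspan_elementary by simp
    then obtain w where w: "net w" "dist w v < e / 3"
      using \<open>e / 3 > 0\<close> net_span unfolding closure_approachable by blast
    obtain M where M: "\<And>J J'. finite J \<Longrightarrow> finite J' \<Longrightarrow> {..<M} \<subseteq> J \<Longrightarrow> {..<M} \<subseteq> J' \<Longrightarrow>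
        dist (R J w) (R J' w) < e / 3"
      using \<open>net w\<close> \<open>e / 3 > 0\<close> unfolding net_def by metis
    \<comment> \<open>This approximation error is the same for every \<open>J\<close>, as each
      \<open>R J\<close> is an isometry; hence the three-term estimate is uniform along the
      net.\<close>
    have R_dist: "dist (R J w) (R J v) < e / 3" if "finite J" for J
      using w(2) R(2)[OF that, of "w - v"] by (simp add: dist_norm R_diff that)
    have "dist (R J v) (R J' v) < e"
      if "finite J" "finite J'" "{..<M} \<subseteq> J" "{..<M} \<subseteq> J'" for J J'
      by (rule dist_triangle_third[of _ "R J w" _ "R J' w"])
        (use M[OF that] R_dist[OF that(1)] R_dist[OF that(2)] in \<open>simp_all add: dist_commute\<close>)
    thus "\<exists>M. \<forall>J J'. finite J \<longrightarrow> finite J' \<longrightarrow> {..<M} \<subseteq> J \<longrightarrow> {..<M} \<subseteq> J' \<longrightarrow>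
        dist (R J v) (R J' v) < e"
      by blast
  qed
  \<comment> \<open>A candidate limit comes from the sequence of initial segments; the Cauchy
    condition then compares an arbitrary large \<open>J\<close> with one late segment.\<close>
  have "convergent (\<lambda>m. R {..<m} v)" for v
  proof (rule Cauchy_convergent, rule metric_CauchyI)
    fix e :: real assume "e > 0"
    then obtain M where M: "\<And>J J'. finite J \<Longrightarrow> finite J' \<Longrightarrow> {..<M} \<subseteq> J \<Longrightarrow> {..<M} \<subseteq> J' \<Longrightarrow>
        dist (R J v) (R J' v) < e"
      using net[of v] unfolding net_def by metis
    show "\<exists>M. \<forall>m\<ge>M. \<forall>n\<ge>M. dist (R {..<m} v) (R {..<n} v) < e"
      by (intro exI[of _ M] allI impI M) auto
  qed
  then obtain S where S: "\<And>v. (\<lambda>m. R {..<m} v) \<longlonglongrightarrow> S v"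
    unfolding convergent_def by metis
  have "((\<lambda>J. R J v) \<longlongrightarrow> S v) (finite_subsets_at_top UNIV)" for v
  proof (rule tendstoI)
    fix e :: real assume "e > 0"
    hence "e / 2 > 0" by simp
    then obtain M where M: "\<And>J J'. finite J \<Longrightarrow> finite J' \<Longrightarrow> {..<M} \<subseteq> J \<Longrightarrow> {..<M} \<subseteq> J' \<Longrightarrow>
        dist (R J v) (R J' v) < e / 2"
      using net[of v] unfolding net_def by metis
    obtain m where m: "m \<ge> M" "dist (R {..<m} v) (S v) < e / 2"
      using eventually_conj[OF tendstoD[OF S \<open>e / 2 > 0\<close>] eventually_ge_at_top[of M]]
      by (auto simp: eventually_sequentially)
    have "dist (R J v) (S v) < e" if "finite J" "{..<M} \<subseteq> J" for J
      by (rule dist_triangle_half_r[of "R {..<m} v"])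
        (use M[of "{..<m}" J] that m in auto)
    thus "\<forall>\<^sub>F J in finite_subsets_at_top UNIV. dist (R J v) (S v) < e"
      unfolding eventually_finite_subsets_at_top by (intro exI[of _ "{..<M}"]) auto
  qed
  moreover have "bounded_clinear S"
    by (rule bounded_clinear_pointwise_limit[OF R_clinear R(2) S]) auto
  ultimately show ?thesis
    using R(1) unfolding tensor_operator_exists_def by blast
qed

end

section \<open>Matrix coefficients of the projective regular representation\<close>

lemma norm_chi:
  assumes "finite A"
  shows "norm (chi A) = sqrt (real (card A))"
proof -
  have "(norm (chi A))\<^sup>2 = (\<Sum>\<^sub>\<infinity>y\<in>A. 1)"
    unfolding norm_ell2_squared
    by (rule infsum_cong_neutral) (auto simp: ell2_fun_chi[OF assms] indicator_def)
  thus ?thesis using assms by (simp add: real_sqrt_unique)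
qed

text \<open>The cocycle values have modulus 1 and cancel against their conjugates; left translation
  merely permutes the summation index.\<close>

lemma cinner_proj_regular:
  assumes u: "u \<in> normalized_cocycles"
  shows "cinner (proj_regular u x f) (proj_regular u x g) = cinner f g"
proof -
  have unimodular: "cnj (u y x) * u y x = 1" for y
    using u complex_norm_square[of "u y x"] by (simp add: normalized_cocycles_def mult.commute)
  have "cinner (proj_regular u x f) (proj_regular u x g)
      = (\<Sum>\<^sub>\<infinity>y. (cnj (u (- y) x) * u (- y) x) * (cnj (ell2_fun f (- x + y)) * ell2_fun g (- x + y)))"
    unfolding cinner_ell2_def ell2_fun_proj_regular[OF u] complex_cnj_mult by (simp only: mult_ac)
  also have "\<dots> = (\<Sum>\<^sub>\<infinity>y. cnj (ell2_fun f (- x + y)) * ell2_fun g (- x + y))"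
    unfolding unimodular by simp
  also have "\<dots> = cinner f g"
    unfolding cinner_ell2_def
    by (rule infsum_reindex_bij_betw[of "\<lambda>y. - x + y" UNIV UNIV
          "\<lambda>y. cnj (ell2_fun f y) * ell2_fun g y"])
      (auto intro!: bij_betwI[where g = "\<lambda>y. x + y"] simp: add.assoc[symmetric])
  finally show ?thesis .
qed

text \<open>The coefficient averages over \<open>F\<close> the values \<open>u (- y) x\<close> on
  the part of \<open>F\<close> inside its translate by \<open>x\<close>, and 0 elsewhere. The first
  part costs at most the cocycle term; the rest costs 1 per point, which is the Foelner
  defect.\<close>

lemma cmod_one_minus_cinner_proj_regular_le:
  fixes F :: "'g::group_add set"
  assumes u: "u \<in> normalized_cocycles" and F: "finite F" "F \<noteq> {}"
    and \<phi>: "\<phi> = chi F /\<^sub>R sqrt (real (card F))"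
  shows "cmod (1 - cinner \<phi> (proj_regular u x \<phi>))
    \<le> 1 / real (card F) * (\<Sum>y\<in>F. cmod (1 - u (- y) x))
      + \<bar>1 - real (card (F \<inter> (\<lambda>y. x + y) ` F)) / real (card F)\<bar>"
proof -
  let ?c = "real (card F)" and ?I = "F \<inter> (\<lambda>y. x + y) ` F"
  have c: "?c > 0" using F by (simp add: card_gt_0_iff)
  have mem: "- x + y \<in> F \<longleftrightarrow> y \<in> (\<lambda>y. x + y) ` F" for y
    by (auto simp: image_iff add.assoc[symmetric] intro: bexI[of _ "- x + y"])
  have fun_\<phi>: "ell2_fun \<phi> y = indicator F y / complex_of_real (sqrt ?c)" for y
    by (simp add: \<phi> scaleR_ell2_def scaleC_ell2.rep_eq ell2_fun_chi[OF F(1)] field_simps)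
  \<comment> \<open>The normalizing factors of the two copies of \<open>\<phi>\<close> combine to
    the cardinality of \<open>F\<close>, turning the sum into an average.\<close>
  have ss: "complex_of_real (sqrt ?c) * complex_of_real (sqrt ?c) = complex_of_real ?c"
    unfolding of_real_mult[symmetric] by simp
  have "cinner \<phi> (proj_regular u x \<phi>)
      = (\<Sum>\<^sub>\<infinity>y\<in>F. u (- y) x * indicator F (- x + y) / complex_of_real ?c)"
    unfolding cinner_ell2_def ell2_fun_proj_regular[OF u] fun_\<phi>
    by (rule infsum_cong_neutral) (auto simp: ss)
  also have "\<dots> = (\<Sum>y\<in>F. u (- y) x * indicator F (- x + y)) / complex_of_real ?c"
    by (simp only: infsum_finite[OF F(1)] sum_divide_distrib)
  finally have "1 - cinner \<phi> (proj_regular u x \<phi>)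
      = (\<Sum>y\<in>F. 1 - u (- y) x * indicator F (- x + y)) / complex_of_real ?c"
    using c by (simp add: sum_subtractf diff_divide_distrib)
  hence "cmod (1 - cinner \<phi> (proj_regular u x \<phi>))
      = cmod (\<Sum>y\<in>F. 1 - u (- y) x * indicator F (- x + y)) / ?c"
    by (simp add: norm_divide)
  also have "\<dots> \<le> (\<Sum>y\<in>F. cmod (1 - u (- y) x) + (1 - indicator ?I y)) / ?c"
  \<comment> \<open>Termwise: if \<open>y\<close> lies in the translate, the indicator on the right
    is 1 and the cocycle term remains; otherwise the left side is 1 and
    \<open>1 - indicator ?I y\<close> already covers it.\<close>
  proof (intro divide_right_mono sum_norm_le)
    show "cmod (1 - u (- y) x * indicator F (- x + y)) \<le> cmod (1 - u (- y) x) + (1 - indicator ?I y)"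
      if "y \<in> F" for y
      using that mem[of y] by (simp add: indicator_def)
  qed simp
  also have "\<dots> = ((\<Sum>y\<in>F. cmod (1 - u (- y) x)) + (?c - real (card ?I))) / ?c"
    using F(1) by (simp add: sum.distrib sum_subtractf sum.If_cases indicator_def Int_absorb1)
  also have "\<dots> = 1 / ?c * (\<Sum>y\<in>F. cmod (1 - u (- y) x)) + (1 - real (card ?I) / ?c)"
    using c by (simp add: field_simps)
  finally show ?thesis by linarith
qed

theorem theorem3p3:
  fixes u :: "nat \<Rightarrow> 'g::group_add \<Rightarrow> 'g \<Rightarrow> complex"
    and F :: "nat \<Rightarrow> 'g set"
    and U :: "nat \<Rightarrow> 'g \<Rightarrow> 'g ell2 \<Rightarrow> 'g ell2"
    and \<phi> :: "nat \<Rightarrow> 'g ell2"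
  assumes nontrivial: "\<exists>x::'g. x \<noteq> 0"
    and cocycles: "\<And>i. u i \<in> normalized_cocycles"
    and countable: "countable (UNIV :: 'g set)"
    and amenable: "amenable TYPE('g)"
    and sigma_F: "sigma_F_sequence F"
    and summable_u: "\<And>x. summable (\<lambda>i. 1 / real (card (F i)) * (\<Sum>y\<in>F i. cmod (1 - u i (- y) x)))"
    and U_def: "\<And>i. U i = proj_regular (u i)"
    and \<phi>_def: "\<And>i. \<phi> i = chi (F i) /\<^sub>R sqrt (real (card (F i)))"
  shows "(\<forall>i. norm (\<phi> i) = 1) \<and>
    (\<forall>tens :: nat \<Rightarrow> (nat \<Rightarrow> 'g ell2) \<Rightarrow> 'h::chilbert_space.
       infinite_tensor_product \<phi> tens \<longrightarrow> (\<forall>x. tensor_operator_exists tens (\<lambda>i. U i x)))"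
proof (intro conjI allI impI)
  have F: "finite (F i)" "F i \<noteq> {}" for i
    using sigma_F by (auto simp: sigma_F_sequence_def)
  show "norm (\<phi> i) = 1" for i
    using F[of i] by (simp add: \<phi>_def norm_chi card_gt_0_iff)
  fix tens :: "nat \<Rightarrow> (nat \<Rightarrow> 'g ell2) \<Rightarrow> 'h" and x
  assume "infinite_tensor_product \<phi> tens"
  then interpret infinite_tensor_product \<phi> tens .
  show "tensor_operator_exists tens (\<lambda>i. U i x)"
  proof (rule tensor_operator_exists_if_summable)
    show "cinner (U i x v) (U i x w) = cinner v w" for i v w
      unfolding U_def by (rule cinner_proj_regular[OF cocycles])
    \<comment> \<open>The majorant adds the general terms of the cocycle hypothesis and of the
      \<open>sigma_F_sequence\<close> condition at this \<open>x\<close>.\<close>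
    have "summable (\<lambda>i. 1 / real (card (F i)) * (\<Sum>y\<in>F i. cmod (1 - u i (- y) x))
        + \<bar>1 - real (card (F i \<inter> (\<lambda>y. x + y) ` F i)) / real (card (F i))\<bar>)"
      using sigma_F by (intro summable_add summable_u) (auto simp: sigma_F_sequence_def)
    thus "summable (\<lambda>i. cmod (1 - cinner (\<phi> i) (U i x (\<phi> i))))"
      by (rule summable_comparison_test')
        (use cmod_one_minus_cinner_proj_regular_le[OF cocycles F \<phi>_def] in \<open>simp add: U_def\<close>)
  qed
qed

end
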